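(* Let $\Lambda=\{a_1,\dots,a_\ell\}$ be a collection of sequences of positive integers which satisfies Condition $( ** )$ and is good for $\liminf$-$\ell$-recurrence. If a topological dynamical system $(X,T)$ has positive topological entropy, then there exist $\Delta$-weakly mixing subsets of $(X,T)$ along $\Lambda$.
   Context: $\mathbb{N}$ is the set of positive integers, $\ell\in\mathbb{N}$, and a sequence of positive integers is a map $a\colon\mathbb{N}\to\mathbb{N}$. A topological dynamical system $(X,T)$ is a compact metric space $X$ with a homeomorphism $T\colon X\to X$. For $m\in\mathbb{N}$, $(X^m,T^{(m)})$ is the $m$-th product system, where $T^{(m)}(x_1,\dots,x_m)=(Tx_1,\dots,Tx_m)$. Condition $( ** )$ for $\Lambda=\{a_1,\dots,a_\ell\}$: (i) for each $i=1,\dots,\ell$ and every $L>0$, $\lim_{N\to\infty}\frac{1}{N^2}\#\{(m,n)\in[1,N]^2: |a_i(m)-a_i(n)|\le L\}=0$ (integer pairs $(m,n)$); and (ii) $\lim_{n\to\infty}(a_{i+1}(n)-a_i(n))=+\infty$ for $i=1,\dots,\ell-1$. A measure preserving system $(X,\mathscr{B},\mu,T)$ consists of a standard Borel space $(X,\mathscr{B})$, a probability measure $\mu$ on it and an invertible measure preserving transformation $T$. The collection $\Lambda$ is good for $\liminf$-$\ell$-recurrence if for every measure preserving system $(X,\mathscr{B},\mu,T)$ and every $A\in\mathscr{B}$ with $\mu(A)>0$, $$\liminf_{N\to\infty}\frac1N\sum_{n=1}^N\mu(A\cap T^{-a_1(n)}A\cap\dots\cap T^{-a_\ell(n)}A)>0.$$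 For a topological dynamical system $(X,T)$, a closed subset $E$ of $X$ is $\Delta$-transitive along $\Lambda$ if there is a residual subset $A$ of $E$ such that for every $x\in A$, $E^\ell\subseteq\overline{\{(T^{a_1(n)}x,\dots,T^{a_\ell(n)}x):n\in\mathbb{N}\}}$. A closed subset $E$ of $X$ is $\Delta$-weakly mixing along $\Lambda$ if for every $m\in\mathbb{N}$, $E^m$ is a $\Delta$-transitive subset of $(X^m,T^{(m)})$ along $\Lambda$. *)

theory Defs
  imports "HOL-Probability.Probability"
begin

text \<open>
  A collection \<open>\<Lambda> = {a\<^sub>1, \<dots>, a\<^sub>\<ell>}\<close> of sequences of positive integers is an \<open>a :: nat \<Rightarrow> nat \<Rightarrow> nat\<close>
  together with \<open>l\<close>: the \<open>n\<close>-th term of \<open>a\<^sub>i\<close> is \<open>a i n\<close>, for \<open>i \<in> {1..l}\<close> and \<open>n \<ge> 1\<close>.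
  Values at other arguments are irrelevant.
\<close>

definition positive_sequences :: "nat \<Rightarrow> (nat \<Rightarrow> nat \<Rightarrow> nat) \<Rightarrow> bool" where
  "positive_sequences l a \<longleftrightarrow> 1 \<le> l \<and> (\<forall>i\<in>{1..l}. \<forall>n\<ge>1. 1 \<le> a i n)"

definition condition_ss :: "nat \<Rightarrow> (nat \<Rightarrow> nat \<Rightarrow> nat) \<Rightarrow> bool" where
  "condition_ss l a \<longleftrightarrow>
     (\<forall>i\<in>{1..l}. \<forall>L::real. L > 0 \<longrightarrow>
        (\<lambda>N. real (card {(m, n). m \<in> {1..N} \<and> n \<in> {1..N} \<and> \<bar>real (a i m) - real (a i n)\<bar> \<le> L})
               / (real N)\<^sup>2) \<longlonglongrightarrow> 0) \<and>
     (\<forall>i\<in>{1..<l}. filterlim (\<lambda>n. real (a (i + 1) n) - real (a i n)) at_top sequentially)"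


definition standard_borel :: "'b measure \<Rightarrow> bool" where
  "standard_borel M \<longleftrightarrow>
     (\<exists>S. completely_metrizable_space S \<and> second_countable S \<and>
          space M = topspace S \<and> sets M = sigma_sets (topspace S) {U. openin S U})"

definition measure_preserving_system :: "'b measure \<Rightarrow> ('b \<Rightarrow> 'b) \<Rightarrow> bool" where
  "measure_preserving_system M T \<longleftrightarrow>
     standard_borel M \<and> prob_space M \<and>
     bij_betw T (space M) (space M) \<and>
     T \<in> measurable M M \<and> the_inv_into (space M) T \<in> measurable M M \<and>
     (\<forall>A\<in>sets M. emeasure M (T -` A \<inter> space M) = emeasure M A)"

text \<open>
  HOL cannot quantify over all types inside a formula. The systems below live on arbitrary subsets
  of the type \<open>real\<close>, carrying an arbitrary standard Borel structure (not necessarily the one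
  induced by the reals). This loses no generality: a standard Borel space has at most continuum many
  points, so every measure preserving system can be transported along an injection into \<open>real\<close>.
\<close>

definition good_for_liminf_recurrence :: "nat \<Rightarrow> (nat \<Rightarrow> nat \<Rightarrow> nat) \<Rightarrow> bool" where
  "good_for_liminf_recurrence l a \<longleftrightarrow>
     (\<forall>(M :: real measure) T A.
        measure_preserving_system M T \<longrightarrow> A \<in> sets M \<longrightarrow> measure M A > 0 \<longrightarrow>
        liminf (\<lambda>N. ereal (1 / real N *
            (\<Sum>n=1..N. measure M (A \<inter> (\<Inter>i\<in>{1..l}. (T ^^ a i n) -` A \<inter> space M))))) > 0)"


text \<open>
  Compact metric spaces are represented by their topologies, as all notions below are topological.
\<close>

definition topological_dynamical_system :: "'a topology \<Rightarrow> ('a \<Rightarrow> 'a) \<Rightarrow> bool" where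
  "topological_dynamical_system X T \<longleftrightarrow>
     compact_space X \<and> metrizable_space X \<and> homeomorphic_map X X T"

text \<open>
  \<open>X\<^sup>m\<close> is the topological product over \<open>{1..m}\<close>; its points are the extensional functions
  \<open>{1..m} \<rightarrow>\<^sub>E topspace X\<close>.
\<close>

definition power_space :: "nat \<Rightarrow> 'a topology \<Rightarrow> (nat \<Rightarrow> 'a) topology" where
  "power_space m X = product_topology (\<lambda>_. X) {1..m}"

definition power_map :: "nat \<Rightarrow> ('a \<Rightarrow> 'a) \<Rightarrow> (nat \<Rightarrow> 'a) \<Rightarrow> (nat \<Rightarrow> 'a)" where
  "power_map m T x = (\<lambda>i\<in>{1..m}. T (x i))"

definition power_set :: "nat \<Rightarrow> 'a set \<Rightarrow> (nat \<Rightarrow> 'a) set" where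
  "power_set m E = {1..m} \<rightarrow>\<^sub>E E"


text \<open>
  Topological entropy is defined by open covers (Adler, Konheim and McAndrew).
\<close>

definition open_cover :: "'a topology \<Rightarrow> 'a set set \<Rightarrow> bool" where
  "open_cover X \<U> \<longleftrightarrow> (\<forall>U\<in>\<U>. openin X U) \<and> \<Union>\<U> = topspace X"

definition min_subcover_card :: "'a topology \<Rightarrow> 'a set set \<Rightarrow> nat" where
  "min_subcover_card X \<U> = (LEAST k. \<exists>\<V>\<subseteq>\<U>. finite \<V> \<and> card \<V> = k \<and> \<Union>\<V> = topspace X)"

text \<open>
  The common refinement \<open>\<U> \<or> T\<^sup>-\<^sup>1\<U> \<or> \<dots> \<or> T\<^sup>-\<^sup>(\<^sup>n\<^sup>-\<^sup>1\<^sup>)\<U>\<close>.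
\<close>

definition iterated_join :: "'a topology \<Rightarrow> ('a \<Rightarrow> 'a) \<Rightarrow> 'a set set \<Rightarrow> nat \<Rightarrow> 'a set set" where
  "iterated_join X T \<U> n =
     {topspace X \<inter> (\<Inter>k\<in>{..<n}. (T ^^ k) -` W k) | W. \<forall>k<n. W k \<in> \<U>}"

text \<open>
  The limit defining the entropy of a cover exists by subadditivity, so that it is the \<open>limsup\<close>.
\<close>

definition cover_entropy :: "'a topology \<Rightarrow> ('a \<Rightarrow> 'a) \<Rightarrow> 'a set set \<Rightarrow> ereal" where
  "cover_entropy X T \<U> =
     limsup (\<lambda>n. ereal (1 / real n * ln (real (min_subcover_card X (iterated_join X T \<U> n)))))"

definition topological_entropy :: "'a topology \<Rightarrow> ('a \<Rightarrow> 'a) \<Rightarrow> ereal" where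
  "topological_entropy X T = (SUP \<U>\<in>{\<U>. open_cover X \<U>}. cover_entropy X T \<U>)"


text \<open>
  Residual: containing a countable intersection of dense open sets.
\<close>

definition residual_in :: "'a topology \<Rightarrow> 'a set \<Rightarrow> bool" where
  "residual_in Y A \<longleftrightarrow> A \<subseteq> topspace Y \<and>
     (\<exists>\<G>. countable \<G> \<and> (\<forall>G\<in>\<G>. openin Y G \<and> Y closure_of G = topspace Y) \<and>
          topspace Y \<inter> \<Inter>\<G> \<subseteq> A)"

definition Delta_transitive ::
    "nat \<Rightarrow> (nat \<Rightarrow> nat \<Rightarrow> nat) \<Rightarrow> 'a topology \<Rightarrow> ('a \<Rightarrow> 'a) \<Rightarrow> 'a set \<Rightarrow> bool" where
  "Delta_transitive l a X T E \<longleftrightarrow>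
     closedin X E \<and>
     (\<exists>A. residual_in (subtopology X E) A \<and>
        (\<forall>x\<in>A. power_set l E \<subseteq>
           power_space l X closure_of {(\<lambda>i\<in>{1..l}. (T ^^ a i n) x) | n. n \<ge> 1}))"

definition Delta_weakly_mixing ::
    "nat \<Rightarrow> (nat \<Rightarrow> nat \<Rightarrow> nat) \<Rightarrow> 'a topology \<Rightarrow> ('a \<Rightarrow> 'a) \<Rightarrow> 'a set \<Rightarrow> bool" where
  "Delta_weakly_mixing l a X T E \<longleftrightarrow>
     closedin X E \<and>
     (\<forall>m\<ge>1. Delta_transitive l a (power_space m X) (power_map m T) (power_set m E))"

end

theory Submission
  imports Defs
begin

text \<open>
  The proof is combinatorial; it works with independence sets in place of
  measure-theoretic entropy. A set \<open>W\<close> of times is an independence set for a family of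
  subsets \<open>A\<^sub>s\<close> of the space (\<open>s \<in> S\<close>) if every itinerary \<open>W \<rightarrow> S\<close> is realised by the orbit
  of some point. The family is densely independent if, for some \<open>c > 0\<close>, infinitely many
  intervals \<open>{..<N}\<close> contain an independence set with at least \<open>c * N\<close> elements. Three
  facts carry the argument.

  Positive entropy produces two disjoint closed sets that are densely independent
  (\<open>positive_entropy_imp_independent_pair\<close>). Dense independence survives shrinking: if
  every \<open>A\<^sub>s\<close> is covered by finitely many pieces, then for some choice of one piece for
  each \<open>s\<close> the chosen pieces are still densely independent (\<open>densely_independent_refine\<close>).
  Both are instances of one lemma of Sauer--Shelah type: a set of words which
  exponentially many boxes are needed to cover shatters a pattern on a positive proportion
  of the coordinates (\<open>exponential_cover_shatters\<close>).

  Dense independence also survives splitting (\<open>densely_independent_extend\<close>): for some \<open>n\<close>,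
  the sets \<open>{x \<in> C. \<forall>i. (T ^^ a i n) x \<in> f i}\<close>, where \<open>C, f 1, \<dots>, f l\<close> range over the
  family in all possible ways, are again densely independent. Indeed, if \<open>W\<close> is an
  independence set for the family, then an independence set for the new one is any set of
  \<open>j\<close> for which the times \<open>j, j + a 1 n, \<dots>, j + a l n\<close> lie in \<open>W\<close> and no time arises
  twice. That there are many such \<open>j\<close> follows from the recurrence hypothesis, carried over
  from measure preserving systems to dense sets of integers by Furstenberg's
  correspondence principle (\<open>recurrence_of_dense_sets\<close>).

  Starting from the independent pair and alternately splitting and shrinking, one obtains
  finite families \<open>\<C>\<^sub>k\<close> of closed sets with diameters tending to \<open>0\<close>, in which every
  \<open>C \<in> \<C>\<^sub>k\<close> contains, for each choice of targets \<open>f 1, \<dots>, f l \<in> \<C>\<^sub>k\<close>, a member of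
  \<open>\<C>\<^sub>k\<^sub>+\<^sub>1\<close> that every \<open>T ^^ a i n\<close> maps into \<open>f i\<close>, with one and the same \<open>n\<close> for all \<open>C\<close>
  and all targets. The set \<open>E = \<Inter>\<^sub>k \<Union>\<C>\<^sub>k\<close> then satisfies the open-set criterion for
  \<open>\<Delta>\<close>-weak mixing (\<open>Delta_weakly_mixing_criterion\<close>), for all powers of the system at once
  because \<open>n\<close> is common; and it has two points because the initial pair is disjoint.
\<close>

section \<open>Shattering of patterns by sets of large cover number\<close>

text \<open>
  The complements of the few sets \<open>A x\<close> cover \<open>U\<close> up to the intersection. If all these
  complements are small compared with \<open>t\<close>, then the intersection is large; otherwise \<open>U\<close>
  is noticeably larger than \<open>t\<close>. Either way the two cardinalities add up to more than \<open>t\<close>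
  by a constant factor.
\<close>

lemma card_Inter_lower_bound:
  fixes A :: "'i \<Rightarrow> 'u set"
  assumes "finite U" "finite P" "P \<noteq> {}" "card P \<le> K" "2 \<le> card P"
    and "\<And>x. x \<in> P \<Longrightarrow> A x \<subseteq> U" and t: "\<And>x. x \<in> P \<Longrightarrow> t \<le> real (card (A x))" "0 \<le> t"
  shows "(1 + 1 / real K) * t \<le> real (card U) + real (card (\<Inter>x\<in>P. A x))"
proof -
  have K: "2 \<le> K" using assms by linarith
  let ?u = "real (card U)" and ?i = "real (card (\<Inter>x\<in>P. A x))" and ?k = "real (card P)"
  have I: "(\<Inter>x\<in>P. A x) \<subseteq> U" using assms by blast
  have diff: "real (card (U - B)) = ?u - real (card B)" if "B \<subseteq> U" for B
    using that assms(1) by (simp add: card_Diff_subset finite_subset card_mono of_nat_diff)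
  have "U - (\<Inter>x\<in>P. A x) = (\<Union>x\<in>P. U - A x)" by auto
  then have "card (U - (\<Inter>x\<in>P. A x)) \<le> (\<Sum>x\<in>P. card (U - A x))"
    using card_UN_le[OF assms(2), of "\<lambda>x. U - A x"] by simp
  then have "real (card (U - (\<Inter>x\<in>P. A x))) \<le> (\<Sum>x\<in>P. real (card (U - A x)))"
    by (simp only: of_nat_sum[symmetric] of_nat_le_iff)
  then have "?u - ?i \<le> (\<Sum>x\<in>P. real (card (U - A x)))"
    unfolding diff[OF I] .
  also have "\<dots> \<le> (\<Sum>x\<in>P. ?u - t)"
  proof (rule sum_mono)
    fix x assume x: "x \<in> P"
    show "real (card (U - A x)) \<le> ?u - t"
      unfolding diff[OF assms(6)[OF x]] using t(1)[OF x] by linarith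
  qed
  finally have *: "?u - ?i \<le> ?k * (?u - t)" by simp
  obtain x where "x \<in> P" using assms by blast
  then have ut: "t \<le> ?u" using t(1)[OF \<open>x \<in> P\<close>] card_mono[OF assms(1) assms(6)[OF \<open>x \<in> P\<close>]] by linarith
  show ?thesis
  proof (cases "t / K \<le> ?u - t")
    case True
    then show ?thesis by (simp add: algebra_simps)
  next
    case False
    have "(?k - 2) * (?u - t) \<le> (K - 1) * (t / K)"
      using False assms ut K by (intro mult_mono) (auto simp: of_nat_diff)
    also have "\<dots> = t - t / K" using K by (simp add: field_simps of_nat_diff)
    finally have "(?k - 2) * (?u - t) \<le> t - t / K" .
    then show ?thesis using * by (simp add: algebra_simps)
  qed
qed

text \<open>
  Points \<open>y\<close> are recorded through their letters \<open>f j y\<close> at times \<open>j\<close>. A pattern is a set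
  of letters which one would like to see occur freely, independently at many times. Two
  choices of patterns are used below: pairs of letters naming disjoint sets, and
  transversals of a partition of the alphabet. Patterns have at least two elements, so
  that sets consisting of a single letter avoid them.
\<close>

locale pattern_system =
  fixes alphabet :: "'c set" and patterns :: "'c set set"
  assumes finite_alphabet: "finite alphabet"
    and pattern_subset: "\<And>P. P \<in> patterns \<Longrightarrow> P \<subseteq> alphabet"
    and card_pattern: "\<And>P. P \<in> patterns \<Longrightarrow> 2 \<le> card P"
begin

lemma finite_patterns: "finite patterns"
  using finite_alphabet pattern_subset by (meson Pow_iff finite_Pow_iff finite_subset subsetI)

definition avoiding :: "'c set set" where
  "avoiding = {D. D \<subseteq> alphabet \<and> (\<forall>P\<in>patterns. \<not> P \<subseteq> D)}"

definition box_cover :: "(nat \<Rightarrow> 'p \<Rightarrow> 'c) \<Rightarrow> nat set \<Rightarrow> 'p set \<Rightarrow> (nat \<Rightarrow> 'c set) set \<Rightarrow> bool" where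
  "box_cover f J Y \<B> \<longleftrightarrow> finite \<B> \<and> (\<forall>D\<in>\<B>. \<forall>j\<in>J. D j \<in> avoiding) \<and>
     (\<forall>y\<in>Y. \<exists>D\<in>\<B>. \<forall>j\<in>J. f j y \<in> D j)"

definition cover_number :: "(nat \<Rightarrow> 'p \<Rightarrow> 'c) \<Rightarrow> nat set \<Rightarrow> 'p set \<Rightarrow> nat" where
  "cover_number f J Y = (LEAST k. \<exists>\<B>. box_cover f J Y \<B> \<and> card \<B> = k)"

text \<open>
  A labelling attaches to each coordinate a pattern, or the empty set if the coordinate is
  not used. Labellings rather than sets of coordinates are counted because different
  patterns may turn up at different coordinates; a single pattern is selected only at the
  very end.
\<close>

definition shattered :: "(nat \<Rightarrow> 'p \<Rightarrow> 'c) \<Rightarrow> nat set \<Rightarrow> 'p set \<Rightarrow> (nat \<Rightarrow> 'c set) set" where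
  "shattered f J Y = {p \<in> J \<rightarrow>\<^sub>E insert {} patterns.
     \<forall>\<tau>. (\<forall>j\<in>J. p j \<noteq> {} \<longrightarrow> \<tau> j \<in> p j) \<longrightarrow> (\<exists>y\<in>Y. \<forall>j\<in>J. p j \<noteq> {} \<longrightarrow> f j y = \<tau> j)}"

lemma singleton_avoiding: "x \<in> alphabet \<Longrightarrow> {x} \<in> avoiding"
  using card_pattern by (fastforce simp: avoiding_def dest: card_mono[rotated])

lemma box_cover_exists:
  assumes "finite J" "\<And>j y. f j y \<in> alphabet"
  shows "\<exists>\<B>. box_cover f J Y \<B>"
proof -
  let ?B = "J \<rightarrow>\<^sub>E (\<lambda>x. {x}) ` alphabet"
  have "\<exists>D\<in>?B. \<forall>j\<in>J. f j y \<in> D j" for y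
    using assms(2) by (intro bexI[of _ "\<lambda>j\<in>J. {f j y}"]) auto
  moreover have "D j \<in> avoiding" if "D \<in> ?B" "j \<in> J" for D j
    using PiE_mem[OF that] singleton_avoiding by auto
  moreover have "finite ?B" using assms(1) finite_alphabet by (simp add: finite_PiE)
  ultimately have "box_cover f J Y ?B" unfolding box_cover_def by blast
  then show ?thesis by blast
qed

lemma box_coverD:
  assumes "box_cover f J Y \<B>" "y \<in> Y"
  shows "\<exists>D\<in>\<B>. \<forall>j\<in>J. f j y \<in> D j"
  using assms unfolding box_cover_def by blast

lemma minimal_box_cover:
  assumes "finite J" "\<And>j y. f j y \<in> alphabet"
  obtains \<B> where "box_cover f J Y \<B>" "card \<B> = cover_number f J Y"
proof -
  have "\<exists>k. \<exists>\<B>. box_cover f J Y \<B> \<and> card \<B> = k"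
    using box_cover_exists[of J f Y, OF assms] by blast
  from LeastI_ex[OF this] show ?thesis
    using that unfolding cover_number_def by blast
qed

lemma cover_number_le: "box_cover f J Y \<B> \<Longrightarrow> cover_number f J Y \<le> card \<B>"
  unfolding cover_number_def by (rule Least_le) blast

text \<open>
  The coordinate \<open>j\<close> splits \<open>Y\<close> according to the letter shown there. If the letters
  outside \<open>Z\<close> contain no pattern, all points showing one of them are covered by boxes over
  \<open>J\<close> with the side \<open>alphabet - Z\<close> attached at \<open>j\<close>; every letter in \<open>Z\<close> gets boxes of its
  own, with a singleton side.
\<close>

lemma cover_number_insert:
  assumes J: "finite J" "j \<notin> J" and f: "\<And>j y. f j y \<in> alphabet"
    and Z: "Z \<subseteq> alphabet" "alphabet - Z \<in> avoiding"
  shows "cover_number f (insert j J) Y \<le>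
    cover_number f J Y + (\<Sum>x\<in>Z. cover_number f J {y\<in>Y. f j y = x})"
proof -
  obtain \<B> where B: "box_cover f J Y \<B>" "card \<B> = cover_number f J Y"
    using minimal_box_cover[of J f Y, OF J(1) f] by blast
  have "\<exists>\<C>. box_cover f J {y\<in>Y. f j y = x} \<C> \<and> card \<C> = cover_number f J {y\<in>Y. f j y = x}" for x
    using minimal_box_cover[of J f "{y\<in>Y. f j y = x}", OF J(1) f] by blast
  then obtain \<C> where C: "\<And>x. box_cover f J {y\<in>Y. f j y = x} (\<C> x)"
      "\<And>x. card (\<C> x) = cover_number f J {y\<in>Y. f j y = x}"
    by metis
  define \<D> where "\<D> = (\<lambda>D. D(j := alphabet - Z)) ` \<B> \<union> (\<Union>x\<in>Z. (\<lambda>D. D(j := {x})) ` \<C> x)"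
  have fZ: "finite Z" using Z finite_alphabet finite_subset by blast
  have "box_cover f (insert j J) Y \<D>"
    unfolding box_cover_def
  proof (intro conjI ballI)
    show "finite \<D>" using B C fZ by (auto simp: \<D>_def box_cover_def)
    show "D i \<in> avoiding" if "D \<in> \<D>" "i \<in> insert j J" for D i
      using that B(1) C(1) Z singleton_avoiding J(2) unfolding \<D>_def box_cover_def by fastforce
    show "\<exists>D\<in>\<D>. \<forall>i\<in>insert j J. f i y \<in> D i" if y: "y \<in> Y" for y
    proof (cases "f j y \<in> Z")
      case True
      then obtain D where "D \<in> \<C> (f j y)" "\<forall>i\<in>J. f i y \<in> D i"
        using box_coverD[OF C(1)[of "f j y"], of y] y by auto
      then show ?thesis using True J(2)
        by (intro bexI[of _ "D(j := {f j y})"]) (auto simp: \<D>_def)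
    next
      case False
      obtain D where "D \<in> \<B>" "\<forall>i\<in>J. f i y \<in> D i"
        using box_coverD[OF B(1) y] by auto
      then show ?thesis using False J(2) f
        by (intro bexI[of _ "D(j := alphabet - Z)"]) (auto simp: \<D>_def)
    qed
  qed
  then have "cover_number f (insert j J) Y \<le> card \<D>" by (rule cover_number_le)
  also have "\<dots> \<le> card ((\<lambda>D. D(j := alphabet - Z)) ` \<B>) + card (\<Union>x\<in>Z. (\<lambda>D. D(j := {x})) ` \<C> x)"
    unfolding \<D>_def by (rule card_Un_le)
  also have "\<dots> \<le> card \<B> + (\<Sum>x\<in>Z. card (\<C> x))"
  proof (rule add_mono)
    show "card ((\<lambda>D. D(j := alphabet - Z)) ` \<B>) \<le> card \<B>"
      using B by (intro card_image_le) (auto simp: box_cover_def)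
    have "card (\<Union>x\<in>Z. (\<lambda>D. D(j := {x})) ` \<C> x) \<le> (\<Sum>x\<in>Z. card ((\<lambda>D. D(j := {x})) ` \<C> x))"
      by (rule card_UN_le[OF fZ])
    also have "\<dots> \<le> (\<Sum>x\<in>Z. card (\<C> x))"
      using C by (intro sum_mono card_image_le) (auto simp: box_cover_def)
    finally show "card (\<Union>x\<in>Z. (\<lambda>D. D(j := {x})) ` \<C> x) \<le> (\<Sum>x\<in>Z. card (\<C> x))" .
  qed
  finally show ?thesis using B C by simp
qed

lemma finite_shattered: "finite J \<Longrightarrow> finite (shattered f J Y)"
  unfolding shattered_def using finite_patterns by (auto intro!: finite_PiE)

lemma shattered_mono: "Y \<subseteq> Y' \<Longrightarrow> shattered f J Y \<subseteq> shattered f J Y'"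
  unfolding shattered_def by blast

lemma shattered_insert_empty:
  assumes "j \<notin> J" "p \<in> shattered f J Y"
  shows "p(j := {}) \<in> shattered f (insert j J) Y"
proof -
  have p: "p \<in> J \<rightarrow>\<^sub>E insert {} patterns" using assms(2) unfolding shattered_def by auto
  have "\<exists>y\<in>Y. \<forall>i\<in>insert j J. (p(j := {})) i \<noteq> {} \<longrightarrow> f i y = \<tau> i"
    if t: "\<forall>i\<in>insert j J. (p(j := {})) i \<noteq> {} \<longrightarrow> \<tau> i \<in> (p(j := {})) i" for \<tau>
  proof -
    have "\<forall>i\<in>J. p i \<noteq> {} \<longrightarrow> \<tau> i \<in> p i" using t assms(1) by (metis fun_upd_other insertCI)
    then obtain y where "y \<in> Y" "\<forall>i\<in>J. p i \<noteq> {} \<longrightarrow> f i y = \<tau> i"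
      using assms(2) unfolding shattered_def by blast
    then show ?thesis by (intro bexI[of _ y]) auto
  qed
  moreover have "p(j := {}) \<in> insert j J \<rightarrow>\<^sub>E insert {} patterns"
    using p by (auto simp: PiE_iff extensional_def)
  ultimately show ?thesis unfolding shattered_def by blast
qed

lemma shattered_insert_pattern:
  assumes "j \<notin> J" "P \<in> patterns" "\<And>x. x \<in> P \<Longrightarrow> p \<in> shattered f J {y\<in>Y. f j y = x}"
  shows "p(j := P) \<in> shattered f (insert j J) Y"
proof -
  have "P \<noteq> {}" using card_pattern[OF assms(2)] by auto
  then have p: "p \<in> J \<rightarrow>\<^sub>E insert {} patterns" using assms(3) unfolding shattered_def by auto
  have "\<exists>y\<in>Y. \<forall>i\<in>insert j J. (p(j := P)) i \<noteq> {} \<longrightarrow> f i y = \<tau> i"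
    if t: "\<forall>i\<in>insert j J. (p(j := P)) i \<noteq> {} \<longrightarrow> \<tau> i \<in> (p(j := P)) i" for \<tau>
  proof -
    have "\<tau> j \<in> P" using t \<open>P \<noteq> {}\<close> by simp
    moreover have "\<forall>i\<in>J. p i \<noteq> {} \<longrightarrow> \<tau> i \<in> p i" using t assms(1) by (metis fun_upd_other insertCI)
    ultimately obtain y where "y \<in> Y" "f j y = \<tau> j" "\<forall>i\<in>J. p i \<noteq> {} \<longrightarrow> f i y = \<tau> i"
      using assms(3) unfolding shattered_def by blast
    then show ?thesis by (intro bexI[of _ y]) (use assms(1) in auto)
  qed
  moreover have "p(j := P) \<in> insert j J \<rightarrow>\<^sub>E insert {} patterns"
    using p assms(2) by (auto simp: PiE_iff extensional_def)
  ultimately show ?thesis unfolding shattered_def by blast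
qed

lemma inj_on_shattered_update:
  assumes "j \<notin> J" shows "inj_on (\<lambda>p. p(j := v)) (shattered f J Y)"
proof (rule inj_onI)
  fix p q assume "p \<in> shattered f J Y" "q \<in> shattered f J Y" and eq: "p(j := v) = q(j := v)"
  then have "p \<in> J \<rightarrow>\<^sub>E insert {} patterns" "q \<in> J \<rightarrow>\<^sub>E insert {} patterns"
    unfolding shattered_def by blast+
  then have "p j = q j" using assms by (metis PiE_arb)
  then show "p = q" using eq by (metis fun_upd_triv fun_upd_upd)
qed

text \<open>
  The one-step gain behind every Sauer--Shelah argument: a labelling of \<open>J\<close> that is
  shattered by \<open>Y\<close> extends with the empty label at \<open>j\<close>, and if it is shattered inside the
  section over every letter of \<open>P\<close>, then it extends also with the label \<open>P\<close>.
\<close>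

lemma card_shattered_insert:
  assumes J: "finite J" "j \<notin> J" and P: "P \<in> patterns"
  shows "card (shattered f J Y) + card (\<Inter>x\<in>P. shattered f J {y\<in>Y. f j y = x})
    \<le> card (shattered f (insert j J) Y)"
proof -
  let ?U = "shattered f J Y" and ?I = "\<Inter>x\<in>P. shattered f J {y\<in>Y. f j y = x}"
  have "P \<noteq> {}" using card_pattern[OF P] by auto
  then have I: "?I \<subseteq> ?U" using shattered_mono[of "{y\<in>Y. f j y = _}" Y] by blast
  have "card ?U = card ((\<lambda>p. p(j := {})) ` ?U)"
    by (simp add: card_image inj_on_shattered_update[OF J(2)])
  moreover have "card ?I = card ((\<lambda>p. p(j := P)) ` ?I)"
    using inj_on_subset[OF inj_on_shattered_update[OF J(2)] I] by (simp add: card_image)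
  moreover have "card ((\<lambda>p. p(j := {})) ` ?U) + card ((\<lambda>p. p(j := P)) ` ?I)
      = card ((\<lambda>p. p(j := {})) ` ?U \<union> (\<lambda>p. p(j := P)) ` ?I)"
  proof (rule card_Un_disjoint[symmetric])
    show "finite ((\<lambda>p. p(j := {})) ` ?U)" using finite_shattered[OF J(1)] by blast
    show "finite ((\<lambda>p. p(j := P)) ` ?I)" using finite_shattered[OF J(1)] I finite_subset by blast
    show "(\<lambda>p. p(j := {})) ` ?U \<inter> (\<lambda>p. p(j := P)) ` ?I = {}"
      using \<open>P \<noteq> {}\<close> by (auto dest: fun_cong[of _ _ j])
  qed
  moreover have "card ((\<lambda>p. p(j := {})) ` ?U \<union> (\<lambda>p. p(j := P)) ` ?I)
      \<le> card (shattered f (insert j J) Y)"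
  proof (intro card_mono finite_shattered)
    show "finite (insert j J)" using J by simp
    show "(\<lambda>p. p(j := {})) ` ?U \<union> (\<lambda>p. p(j := P)) ` ?I \<subseteq> shattered f (insert j J) Y"
      using shattered_insert_empty[OF J(2)] shattered_insert_pattern[OF J(2) P] by blast
  qed
  ultimately show ?thesis by linarith
qed

text \<open>
  Induction on the coordinates. Call a letter rare if the section over it has a cover
  number below \<open>\<epsilon>\<close> times the total. If the other letters contain no pattern, then the
  sections over rare letters can be discarded at the cost of a factor \<open>1 - K * \<epsilon>\<close> in the
  cover number, where \<open>K\<close> is the size of the alphabet. Otherwise some pattern consists of
  letters with large sections, and the count of shattered labellings gains a factor
  \<open>1 + 1 / K\<close>, which for small \<open>\<alpha>\<close> makes up for the factor \<open>\<epsilon> powr \<alpha>\<close> lost in passing to a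
  section.
\<close>

lemma card_shattered_ge:
  fixes \<epsilon> \<alpha> :: real
  assumes "finite J" and f: "\<And>j y. f j y \<in> alphabet"
    and eps: "0 < \<epsilon>" "card alphabet * \<epsilon> < 1"
    and alpha: "0 < \<alpha>" "1 \<le> (1 + 1 / real (card alphabet)) * \<epsilon> powr \<alpha>"
  shows "(real (cover_number f J Y) * (1 - card alphabet * \<epsilon>) ^ card J) powr \<alpha>
    \<le> real (card (shattered f J Y))"
  using assms(1)
proof (induction J arbitrary: Y rule: finite_induct)
  case empty
  show ?case
  proof (cases "Y = {}")
    case True
    have "cover_number f {} Y \<le> card ({} :: (nat \<Rightarrow> 'c set) set)"
      by (rule cover_number_le) (auto simp: box_cover_def True)
    then have "cover_number f {} Y = 0" by simp
    then show ?thesis using alpha(1) by (simp only: of_nat_0 mult_zero_left powr_0)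
  next
    case False
    have "cover_number f {} Y \<le> card {\<lambda>_ :: nat. {} :: 'c set}"
      by (rule cover_number_le) (auto simp: box_cover_def)
    then have "(real (cover_number f {} Y)) powr \<alpha> \<le> 1 powr \<alpha>"
      using alpha by (intro powr_mono2) auto
    moreover have "shattered f {} Y = {\<lambda>_. undefined}" using False by (auto simp: shattered_def)
    ultimately show ?thesis by (simp only: card.empty power_0 mult_1_right) simp
  qed
next
  case (insert j J)
  let ?K = "card alphabet" and ?t = "real (cover_number f (insert j J) Y)"
  let ?S = "\<lambda>x. {y\<in>Y. f j y = x}" and ?d = "1 - card alphabet * \<epsilon>"
  have d: "0 < ?d" "?d \<le> 1" using eps by auto
  define Z where "Z = {x \<in> alphabet. real (cover_number f J (?S x)) < \<epsilon> * ?t}"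
  have Zs: "Z \<subseteq> alphabet" by (auto simp: Z_def)
  have fin: "finite (insert j J)" using insert by simp
  show ?case
  proof (cases "alphabet - Z \<in> avoiding")
    case True
    have "?t \<le> real (cover_number f J Y + (\<Sum>x\<in>Z. cover_number f J (?S x)))"
      using cover_number_insert[of J j f Z Y, OF insert(1,2) f Zs True] by (simp only: of_nat_le_iff)
    also have "\<dots> = real (cover_number f J Y) + (\<Sum>x\<in>Z. real (cover_number f J (?S x)))" by simp
    also have "(\<Sum>x\<in>Z. real (cover_number f J (?S x))) \<le> (\<Sum>x\<in>Z. \<epsilon> * ?t)"
      by (rule sum_mono) (auto simp: Z_def)
    also have "(\<Sum>x\<in>Z. \<epsilon> * ?t) \<le> ?K * (\<epsilon> * ?t)"
      using card_mono[OF finite_alphabet Zs] eps by (auto intro!: mult_right_mono)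
    finally have "?t * ?d \<le> real (cover_number f J Y)" by (simp add: algebra_simps)
    then have "(?t * ?d * ?d ^ card J) powr \<alpha> \<le> (real (cover_number f J Y) * ?d ^ card J) powr \<alpha>"
      using d alpha by (intro powr_mono2 mult_right_mono) auto
    also have "\<dots> \<le> card (shattered f J Y)" by (rule insert.IH)
    also have "card (shattered f J Y) = card ((\<lambda>p. p(j := {})) ` shattered f J Y)"
      by (simp add: card_image inj_on_shattered_update[OF insert(2)])
    also have "\<dots> \<le> card (shattered f (insert j J) Y)"
      using shattered_insert_empty[OF insert(2)] by (intro card_mono finite_shattered fin) auto
    finally show ?thesis using insert(1,2) by (simp add: mult.assoc)
  next
    case False
    then obtain P where P: "P \<in> patterns" "P \<subseteq> alphabet - Z" unfolding avoiding_def by blast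
    have Pne: "P \<noteq> {}" "2 \<le> card P" using card_pattern[OF P(1)] by auto
    have PK: "finite P" "card P \<le> ?K"
      using pattern_subset[OF P(1)] finite_alphabet by (auto intro: finite_subset card_mono)
    let ?s = "(\<epsilon> * ?t * ?d ^ card J) powr \<alpha>"
    have large: "?s \<le> real (card (shattered f J (?S x)))" if "x \<in> P" for x
    proof -
      have "\<epsilon> * ?t \<le> real (cover_number f J (?S x))" using that P by (auto simp: Z_def)
      then have "?s \<le> (real (cover_number f J (?S x)) * ?d ^ card J) powr \<alpha>"
        using d alpha eps by (intro powr_mono2 mult_right_mono) auto
      also have "\<dots> \<le> real (card (shattered f J (?S x)))" by (rule insert.IH)
      finally show ?thesis .
    qed
    have "(?t * ?d ^ card (insert j J)) powr \<alpha> \<le> (?t * ?d ^ card J) powr \<alpha>"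
      using d alpha insert(1,2) by (intro powr_mono2 mult_left_mono power_decreasing) auto
    also have "\<dots> \<le> ((1 + 1 / real ?K) * \<epsilon> powr \<alpha>) * (?t * ?d ^ card J) powr \<alpha>"
      using alpha(2) by (metis mult_1 mult_right_mono powr_ge_zero)
    also have "\<dots> = (1 + 1 / real ?K) * ?s"
      using eps d by (simp add: powr_mult mult.assoc)
    also have "\<dots> \<le> real (card (shattered f J Y)) + real (card (\<Inter>x\<in>P. shattered f J (?S x)))"
      using PK Pne large shattered_mono[of "?S _" Y]
      by (intro card_Inter_lower_bound finite_shattered insert(1)) auto
    also have "\<dots> \<le> real (card (shattered f (insert j J) Y))"
      using card_shattered_insert[OF insert(1,2) P(1), of f Y]
      by (simp only: of_nat_add[symmetric] of_nat_le_iff)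
    finally show ?thesis .
  qed
qed

text \<open>
  Weight every nonempty label with a factor \<open>t\<close>. The total weight factorises over the
  coordinates, and a sparse labelling weighs at least \<open>t ^ m\<close>.
\<close>

lemma card_sparse_labellings:
  fixes J :: "nat set" and t :: real
  assumes J: "finite J" and t: "0 < t" "t \<le> 1"
  shows "real (card {p \<in> J \<rightarrow>\<^sub>E insert {} patterns. card {j\<in>J. p j \<noteq> {}} \<le> m}) * t ^ m
    \<le> (1 + real (card patterns) * t) ^ card J"
proof -
  let ?L = "J \<rightarrow>\<^sub>E insert {} patterns"
  let ?w = "\<lambda>v. if v = {} then 1 else t"
  have fL: "finite ?L" using J finite_patterns by (auto intro!: finite_PiE)
  have ne: "{} \<notin> patterns" using card_pattern by fastforce
  have w: "(\<Prod>j\<in>J. ?w (p j)) = t ^ card {j\<in>J. p j \<noteq> {}}" for p :: "nat \<Rightarrow> 'c set"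
    using J by (simp add: prod.If_cases Int_def)
  have "real (card {p \<in> ?L. card {j\<in>J. p j \<noteq> {}} \<le> m}) * t ^ m
      = (\<Sum>p\<in>{p \<in> ?L. card {j\<in>J. p j \<noteq> {}} \<le> m}. t ^ m)" by simp
  also have "\<dots> \<le> (\<Sum>p\<in>{p \<in> ?L. card {j\<in>J. p j \<noteq> {}} \<le> m}. \<Prod>j\<in>J. ?w (p j))"
    unfolding w using t by (intro sum_mono power_decreasing) auto
  also have "\<dots> \<le> (\<Sum>p\<in>?L. \<Prod>j\<in>J. ?w (p j))"
    using fL t by (intro sum_mono2) (auto intro!: prod_nonneg)
  also have "\<dots> = (\<Prod>j\<in>J. \<Sum>v\<in>insert {} patterns. ?w v)"
    using J finite_patterns by (intro prod_sum_PiE[symmetric]) auto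
  also have "(\<Sum>v\<in>insert {} patterns. ?w v) = 1 + real (card patterns) * t"
  proof -
    have "(\<Sum>v\<in>patterns. ?w v) = (\<Sum>v\<in>patterns. t)" using ne by (intro sum.cong) auto
    then show ?thesis using ne finite_patterns by simp
  qed
  finally show ?thesis by simp
qed

text \<open>
  An exponential cover number forces exponentially many shattered labellings, more than
  there are sparse ones. So some shattered labelling is not sparse, and the pattern that
  it uses most often occurs at a positive proportion of the coordinates.
\<close>

theorem exponential_cover_shatters:
  fixes b :: real
  assumes b: "1 < b"
  obtains c where "0 < c"
    and "\<And>(f :: nat \<Rightarrow> 'p \<Rightarrow> 'c) J Y. \<lbrakk>finite J; J \<noteq> {}; \<And>j y. f j y \<in> alphabet;
        \<And>\<B>. box_cover f J Y \<B> \<Longrightarrow> b ^ card J \<le> real (card \<B>)\<rbrakk> \<Longrightarrow>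
      \<exists>P\<in>patterns. \<exists>W\<subseteq>J. c * real (card J) \<le> real (card W) \<and>
        (\<forall>\<tau>. (\<forall>j\<in>W. \<tau> j \<in> P) \<longrightarrow> (\<exists>y\<in>Y. \<forall>j\<in>W. f j y = \<tau> j))"
proof -
  define K where "K = real (card alphabet) + 1"
  have K: "1 \<le> K" by (simp add: K_def)
  \<comment> \<open>so small that discarding rare letters does not consume the growth rate:
    \<open>b * (1 - card alphabet * \<epsilon>) > 1\<close>\<close>
  define \<epsilon> where "\<epsilon> = (1 - 1 / b) / (2 * K)"
  have eps0: "0 < \<epsilon>" using b K by (simp add: \<epsilon>_def)
  have "card alphabet * \<epsilon> < 2 * K * \<epsilon>"
    using eps0 by (simp add: K_def)
  also have "\<dots> = 1 - 1 / b" using K by (simp add: \<epsilon>_def)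
  finally have epsb: "card alphabet * \<epsilon> < 1 - 1 / b" .
  then have eps1: "card alphabet * \<epsilon> < 1" using b by (smt (verit) divide_pos_pos)
  have "2 * K * \<epsilon> < 1 * (2 * K)" using K b by (simp add: \<epsilon>_def) (smt (verit) divide_pos_pos)
  then have eps2: "\<epsilon> < 1" using K by simp
  define d where "d = 1 - card alphabet * \<epsilon>"
  have d: "0 < d" "1 < b * d"
    using eps1 epsb b by (simp_all add: d_def field_simps)
  define \<kappa> where "\<kappa> = 1 + 1 / K"
  have kap: "1 < \<kappa>" using K by (simp add: \<kappa>_def)
  \<comment> \<open>chosen so that \<open>\<kappa> * \<epsilon> powr \<alpha> = 1\<close>\<close>
  define \<alpha> where "\<alpha> = ln \<kappa> / - ln \<epsilon>"
  have alpha0: "0 < \<alpha>" using kap eps0 eps2 by (simp add: \<alpha>_def divide_pos_neg)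
  have "\<epsilon> powr \<alpha> = exp (- ln \<kappa>)"
    using eps0 eps2 by (simp add: powr_def \<alpha>_def)
  then have ea: "\<epsilon> powr \<alpha> = 1 / \<kappa>" using kap by (simp add: exp_minus inverse_eq_divide)
  have grow: "1 \<le> (1 + 1 / real (card alphabet)) * \<epsilon> powr \<alpha>" if "0 < card alphabet"
  proof -
    have "\<kappa> \<le> 1 + 1 / real (card alphabet)"
      using that by (simp add: \<kappa>_def K_def frac_le)
    then show ?thesis unfolding ea using kap by simp
  qed
  define g where "g = (b * d) powr \<alpha>"
  have g: "1 < g" unfolding g_def using d alpha0 by simp
  define q where "q = real (card patterns) + 1"
  have q: "1 \<le> q" by (simp add: q_def)
  \<comment> \<open>the number of shattered labellings grows at rate at least \<open>g\<close>, that of sparse ones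
    at most at rate \<open>(1 + card patterns * t) * t powr - c\<close>; both factors are kept
    within \<open>sqrt g\<close>\<close>
  define t where "t = min 1 ((sqrt g - 1) / (2 * q))"
  have sg: "1 < sqrt g" using g by simp
  have t: "0 < t" "t \<le> 1" using sg q by (auto simp: t_def)
  have "card patterns * t \<le> q * t" using t by (simp add: q_def)
  also have "\<dots> \<le> q * ((sqrt g - 1) / (2 * q))" using q by (intro mult_left_mono) (auto simp: t_def)
  also have "\<dots> < sqrt g - 1" using q sg by simp
  finally have qt: "1 + card patterns * t < sqrt g" by simp
  obtain c where c: "0 < c" "1 / sqrt g \<le> t powr c"
  proof (cases "t = 1")
    case True
    then show ?thesis using that[of 1] sg by simp
  next
    case False
    then have lt: "ln t < 0" using t by simp
    show ?thesis
    proof (rule that)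
      show "0 < ln (sqrt g) / - ln t" using lt sg by (simp add: divide_pos_neg)
      show "1 / sqrt g \<le> t powr (ln (sqrt g) / - ln t)"
        using lt sg t by (simp add: powr_def exp_minus inverse_eq_divide)
    qed
  qed
  show ?thesis
  proof (rule that[of "c / q"])
    show "0 < c / q" using c q by simp
    fix f :: "nat \<Rightarrow> 'p \<Rightarrow> 'c" and J Y
    assume J: "finite J" "J \<noteq> {}" and f: "\<And>j y. f j y \<in> alphabet"
      and cov: "\<And>\<B>. box_cover f J Y \<B> \<Longrightarrow> b ^ card J \<le> real (card \<B>)"
    let ?n = "card J"
    have n: "0 < ?n" using J by (simp add: card_gt_0_iff)
    have K0: "0 < card alphabet" using f finite_alphabet card_gt_0_iff by blast
    have "b ^ ?n \<le> real (cover_number f J Y)"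
      using minimal_box_cover[of J f Y, OF J(1) f] cov by metis
    then have "(b ^ ?n * d ^ ?n) powr \<alpha> \<le> (real (cover_number f J Y) * d ^ ?n) powr \<alpha>"
      using b d alpha0 by (intro powr_mono2 mult_right_mono) auto
    also have "\<dots> \<le> card (shattered f J Y)"
      using card_shattered_ge[of J f \<epsilon> \<alpha> Y, OF J(1) f eps0 eps1 alpha0 grow[OF K0]] unfolding d_def by simp
    also have "(b ^ ?n * d ^ ?n) powr \<alpha> = g ^ ?n"
    proof -
      have "(b ^ ?n * d ^ ?n) powr \<alpha> = ((b * d) powr ?n) powr \<alpha>"
        using b d by (simp add: power_mult_distrib powr_realpow)
      also have "\<dots> = ((b * d) powr \<alpha>) powr ?n"
        by (simp only: powr_powr mult.commute)
      finally show ?thesis using b d by (simp add: g_def powr_realpow)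
    qed
    finally have many: "g ^ ?n \<le> card (shattered f J Y)" .
    have "\<exists>p\<in>shattered f J Y. c * ?n \<le> card {j\<in>J. p j \<noteq> {}}"
    proof (rule ccontr)
      assume "\<not> ?thesis"
      then have small: "real (card {j\<in>J. p j \<noteq> {}}) < c * ?n" if "p \<in> shattered f J Y" for p
        using that by fastforce
      define m where "m = nat \<lfloor>c * ?n\<rfloor>"
      have "card {j\<in>J. p j \<noteq> {}} \<le> m" if "p \<in> shattered f J Y" for p
        using small[OF that] unfolding m_def by (simp add: le_nat_floor)
      then have "shattered f J Y \<subseteq> {p \<in> J \<rightarrow>\<^sub>E insert {} patterns. card {j\<in>J. p j \<noteq> {}} \<le> m}"
        by (auto simp: shattered_def)
      then have "card (shattered f J Y) \<le> card {p \<in> J \<rightarrow>\<^sub>E insert {} patterns. card {j\<in>J. p j \<noteq> {}} \<le> m}"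
        using J(1) finite_patterns by (intro card_mono) (auto simp: finite_PiE)
      then have "g ^ ?n * t ^ m \<le> real (card {p \<in> J \<rightarrow>\<^sub>E insert {} patterns. card {j\<in>J. p j \<noteq> {}} \<le> m}) * t ^ m"
        using many t by (intro mult_right_mono) simp_all
      also have "\<dots> \<le> (1 + card patterns * t) ^ ?n"
        by (rule card_sparse_labellings[OF J(1) t])
      also have "\<dots> < sqrt g ^ ?n"
        using qt n t by (intro power_strict_mono) auto
      finally have up: "g ^ ?n * t ^ m < sqrt g ^ ?n" .
      have "(1 / sqrt g) ^ ?n \<le> (t powr c) ^ ?n" using c sg by (intro power_mono) auto
      also have "\<dots> = t powr (c * ?n)" using t by (simp add: powr_powr flip: powr_realpow)
      also have "\<dots> \<le> t powr m"
        using t c by (intro powr_mono') (auto simp: m_def)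
      also have "\<dots> = t ^ m" using t by (simp add: powr_realpow)
      finally have "g ^ ?n * (1 / sqrt g) ^ ?n \<le> g ^ ?n * t ^ m" using g by (intro mult_left_mono) auto
      moreover have "g ^ ?n * (1 / sqrt g) ^ ?n = sqrt g ^ ?n"
        using g by (simp add: power_mult_distrib[symmetric] real_div_sqrt)
      ultimately show False using up by linarith
    qed
    then obtain p where p: "p \<in> shattered f J Y" "c * ?n \<le> card {j\<in>J. p j \<noteq> {}}" by blast
    have pJ: "p j = {} \<or> p j \<in> patterns" if "j \<in> J" for j
      using p(1) that unfolding shattered_def by (auto dest: PiE_mem)
    have "\<exists>P\<in>patterns. c / q * ?n \<le> card {j\<in>J. p j = P}"
    proof (rule ccontr)
      assume "\<not> ?thesis"
      then have *: "card {j\<in>J. p j = P} \<le> c / q * ?n" if "P \<in> patterns" for P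
        using that by force
      have "card {j\<in>J. p j \<noteq> {}} \<le> card (\<Union>P\<in>patterns. {j\<in>J. p j = P})"
        using pJ J(1) finite_patterns by (intro card_mono) auto
      also have "\<dots> \<le> (\<Sum>P\<in>patterns. card {j\<in>J. p j = P})"
        by (rule card_UN_le[OF finite_patterns])
      finally have "real (card {j\<in>J. p j \<noteq> {}}) \<le> (\<Sum>P\<in>patterns. real (card {j\<in>J. p j = P}))"
        by (simp only: of_nat_sum[symmetric] of_nat_le_iff)
      also have "\<dots> \<le> card patterns * (c / q * ?n)"
        using sum_bounded_above[of patterns "\<lambda>P. real (card {j\<in>J. p j = P})", OF *] by simp
      also have "\<dots> < q * (c / q * ?n)" using c q n by (intro mult_strict_right_mono) (auto simp: q_def)
      also have "\<dots> = c * ?n" using q by simp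
      finally show False using p(2) by linarith
    qed
    then obtain P where P: "P \<in> patterns" "c / q * ?n \<le> card {j\<in>J. p j = P}" by blast
    have ne: "Q \<noteq> {}" if "Q \<in> patterns" for Q using card_pattern[OF that] by auto
    have "\<exists>y\<in>Y. \<forall>j\<in>{j\<in>J. p j = P}. f j y = \<tau> j" if tau: "\<forall>j\<in>{j\<in>J. p j = P}. \<tau> j \<in> P" for \<tau>
    proof -
      define \<tau>' where "\<tau>' j = (if p j = P then \<tau> j else SOME v. v \<in> p j)" for j
      have "\<forall>j\<in>J. p j \<noteq> {} \<longrightarrow> \<tau>' j \<in> p j"
        using tau by (auto simp: \<tau>'_def some_in_eq)
      then obtain y where y: "y \<in> Y" "\<forall>j\<in>J. p j \<noteq> {} \<longrightarrow> f j y = \<tau>' j"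
        using p(1) unfolding shattered_def by blast
      have "f j y = \<tau> j" if "j \<in> J" "p j = P" for j
        using y(2) that ne[OF P(1)] by (simp add: \<tau>'_def)
      then show ?thesis using y(1) by blast
    qed
    then show "\<exists>P\<in>patterns. \<exists>W\<subseteq>J. c / q * real (card J) \<le> real (card W) \<and>
        (\<forall>\<tau>. (\<forall>j\<in>W. \<tau> j \<in> P) \<longrightarrow> (\<exists>y\<in>Y. \<forall>j\<in>W. f j y = \<tau> j))"
      using P by (intro bexI[of _ P] exI[of _ "{j\<in>J. p j = P}"]) auto
  qed
qed

end

section \<open>Recurrence of dense sets of integers\<close>

text \<open>
  Furstenberg's correspondence: the dense sets are read as points of the two-sided full
  shift, the frequencies of cylinder sets along their orbits have a limit point, and this
  limit extends to a shift-invariant measure on which the recurrence hypothesis can be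
  evaluated.
\<close>

definition cylinders :: "(int \<Rightarrow> bool) set set" where
  "cylinders = {C. \<exists>J. finite J \<and> (\<forall>x y. (\<forall>k\<in>J. x k = y k) \<longrightarrow> x \<in> C \<longrightarrow> y \<in> C)}"

definition left_shift :: "(int \<Rightarrow> bool) \<Rightarrow> (int \<Rightarrow> bool)" where
  "left_shift x = (\<lambda>k. x (k + 1))"

lemma left_shift_power: "(left_shift ^^ n) x = (\<lambda>k. x (k + int n))"
  by (induction n arbitrary: x) (simp_all add: left_shift_def algebra_simps)

lemma bij_left_shift: "bij left_shift"
  by (rule o_bij[of "\<lambda>x k. x (k - 1)"]) (auto simp: left_shift_def)

lemma cylinderI:
  assumes "finite J" "\<And>x y. (\<And>k. k \<in> J \<Longrightarrow> x k = y k) \<Longrightarrow> x \<in> C \<Longrightarrow> y \<in> C"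
  shows "C \<in> cylinders"
  unfolding cylinders_def
proof (intro CollectI exI[of _ J] conjI allI impI)
  fix x y assume "\<forall>k\<in>J. x k = y k" "x \<in> C"
  then show "y \<in> C" by (intro assms(2)[of x y]) (erule bspec)
qed (rule assms(1))

lemma cylinder_Un: "C \<in> cylinders \<Longrightarrow> D \<in> cylinders \<Longrightarrow> C \<union> D \<in> cylinders"
proof -
  assume "C \<in> cylinders" "D \<in> cylinders"
  then obtain J K where J: "finite J" "\<forall>x y. (\<forall>k\<in>J. x k = y k) \<longrightarrow> x \<in> C \<longrightarrow> y \<in> C"
    and K: "finite K" "\<forall>x y. (\<forall>k\<in>K. x k = y k) \<longrightarrow> x \<in> D \<longrightarrow> y \<in> D"
    unfolding cylinders_def by blast
  show ?thesis
  proof (rule cylinderI[of "J \<union> K"])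
    show "finite (J \<union> K)" using J K by simp
    fix x y assume eq: "\<And>k. k \<in> J \<union> K \<Longrightarrow> x k = y k" and x: "x \<in> C \<union> D"
    have "\<forall>k\<in>J. x k = y k" "\<forall>k\<in>K. x k = y k" by (simp_all add: eq)
    then have "x \<in> C \<Longrightarrow> y \<in> C" "x \<in> D \<Longrightarrow> y \<in> D"
      by (simp_all only: J(2)[THEN spec, THEN spec, THEN mp, THEN mp] K(2)[THEN spec, THEN spec, THEN mp, THEN mp])
    then show "y \<in> C \<union> D" using x by blast
  qed
qed

lemma cylinder_Compl: "C \<in> cylinders \<Longrightarrow> - C \<in> cylinders"
proof -
  assume "C \<in> cylinders"
  then obtain J where J: "finite J" "\<forall>x y. (\<forall>k\<in>J. x k = y k) \<longrightarrow> x \<in> C \<longrightarrow> y \<in> C"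
    unfolding cylinders_def by blast
  show ?thesis
  proof (rule cylinderI[OF J(1)])
    fix x y assume eq: "\<And>k. k \<in> J \<Longrightarrow> x k = y k" and x: "x \<in> - C"
    have "\<forall>k\<in>J. y k = x k" by (simp add: eq)
    then have "y \<in> C \<Longrightarrow> x \<in> C" by (rule J(2)[THEN spec, THEN spec, THEN mp, THEN mp])
    then show "y \<in> - C" using x by blast
  qed
qed

lemma cylinder_algebra: "algebra UNIV cylinders"
  unfolding algebra_iff_Un
proof (intro conjI ballI)
  show "{} \<in> cylinders" by (rule cylinderI[of "{}"]) auto
qed (simp_all add: Compl_eq_Diff_UNIV[symmetric] cylinder_Un cylinder_Compl)

lemma cylinder_shift_vimage: "C \<in> cylinders \<Longrightarrow> left_shift -` C \<in> cylinders"
proof -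
  assume "C \<in> cylinders"
  then obtain J where J: "finite J" "\<forall>x y. (\<forall>k\<in>J. x k = y k) \<longrightarrow> x \<in> C \<longrightarrow> y \<in> C"
    unfolding cylinders_def by blast
  show ?thesis
  proof (rule cylinderI[of "(\<lambda>k. k + 1) ` J"])
    show "finite ((\<lambda>k. k + 1) ` J)" using J by simp
    fix x y :: "int \<Rightarrow> bool" assume *: "\<And>k. k \<in> (\<lambda>k. k + 1) ` J \<Longrightarrow> x k = y k" and x: "x \<in> left_shift -` C"
    have "\<forall>k\<in>J. left_shift x k = left_shift y k" using * by (auto simp: left_shift_def)
    then show "y \<in> left_shift -` C"
      using J(2)[rule_format, of "left_shift x" "left_shift y"] x by simp
  qed
qed

lemma cylinder_shift_image: "C \<in> cylinders \<Longrightarrow> left_shift ` C \<in> cylinders"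
proof -
  assume "C \<in> cylinders"
  then obtain J where J: "finite J" "\<forall>x y. (\<forall>k\<in>J. x k = y k) \<longrightarrow> x \<in> C \<longrightarrow> y \<in> C"
    unfolding cylinders_def by blast
  show ?thesis
  proof (rule cylinderI[of "(\<lambda>k. k - 1) ` J"])
    show "finite ((\<lambda>k. k - 1) ` J)" using J by simp
    fix x y :: "int \<Rightarrow> bool" assume *: "\<And>k. k \<in> (\<lambda>k. k - 1) ` J \<Longrightarrow> x k = y k" and x: "x \<in> left_shift ` C"
    then obtain z where z: "z \<in> C" "x = left_shift z" by blast
    have "\<forall>k\<in>J. z k = y (k - 1)" using * z by (force simp: left_shift_def)
    then have "(\<lambda>k. y (k - 1)) \<in> C" using J(2)[rule_format, of z "\<lambda>k. y (k - 1)"] z(1) by simp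
    then show "y \<in> left_shift ` C" by (rule rev_image_eqI) (simp add: left_shift_def)
  qed
qed

lemma cylinder_neighbourhood:
  assumes "open U" "x \<in> U"
  obtains J where "finite J" "{y. \<forall>k\<in>J. y k = x k} \<subseteq> (U :: (int \<Rightarrow> bool) set)"
proof -
  have "openin (product_topology (\<lambda>_. euclidean) UNIV) U"
    using assms(1) by (simp add: euclidean_product_topology)
  then obtain V where V: "finite {i. V i \<noteq> (UNIV :: bool set)}" "x \<in> Pi\<^sub>E UNIV V" "Pi\<^sub>E UNIV V \<subseteq> U"
    using assms(2) unfolding openin_product_topology_alt by fastforce
  have "{y. \<forall>k\<in>{i. V i \<noteq> UNIV}. y k = x k} \<subseteq> Pi\<^sub>E UNIV V"
  proof
    fix y assume y: "y \<in> {y. \<forall>k\<in>{i. V i \<noteq> UNIV}. y k = x k}"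
    have "y i \<in> V i" for i
      using y PiE_mem[OF V(2), of i] by (cases "V i = UNIV") auto
    then show "y \<in> Pi\<^sub>E UNIV V" by auto
  qed
  then show ?thesis by (intro that[OF V(1)] order_trans[OF _ V(3)])
qed

lemma open_cylinder: "C \<in> cylinders \<Longrightarrow> open C"
proof -
  assume "C \<in> cylinders"
  then obtain J where J: "finite J" "\<forall>x y. (\<forall>k\<in>J. x k = y k) \<longrightarrow> x \<in> C \<longrightarrow> y \<in> C"
    unfolding cylinders_def by blast
  show ?thesis
  proof (rule open_subopen[THEN iffD2], rule ballI)
    fix x assume "x \<in> C"
    let ?V = "\<lambda>k. if k \<in> J then {x k} else UNIV"
    have "open (Pi\<^sub>E UNIV ?V)"
      using J(1) by (intro open_PiE) (auto intro: discrete_topology_class.open_discrete elim: finite_subset[rotated])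
    moreover have "x \<in> Pi\<^sub>E UNIV ?V" by (simp add: PiE_iff)
    moreover have "Pi\<^sub>E UNIV ?V \<subseteq> C"
    proof
      fix y assume "y \<in> Pi\<^sub>E UNIV ?V"
      then have "\<forall>k\<in>J. x k = y k" by (auto simp: PiE_iff split: if_splits)
      then show "y \<in> C"
        using J(2)[rule_format, of x y] \<open>x \<in> C\<close> by simp
    qed
    ultimately show "\<exists>T. open T \<and> x \<in> T \<and> T \<subseteq> C" by blast
  qed
qed

lemma closed_cylinder: "C \<in> cylinders \<Longrightarrow> closed C"
  using open_cylinder[OF cylinder_Compl] by (simp add: closed_def)

lemma countable_cylinder_base:
  "\<exists>\<B>. countable \<B> \<and> \<B> \<subseteq> cylinders \<and> (\<forall>U x. open U \<longrightarrow> x \<in> U \<longrightarrow> (\<exists>B\<in>\<B>. x \<in> B \<and> B \<subseteq> U))"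
proof (intro exI conjI allI impI)
  let ?b = "\<lambda>(J, P). {x :: int \<Rightarrow> bool. \<forall>k\<in>J. x k = (k \<in> P)}"
  let ?F = "{A :: int set. finite A}"
  show "countable (?b ` (?F \<times> ?F))"
    by (intro countable_image countable_SIGMA countable_Collect_finite)
  have "?b (J, P) \<in> cylinders" if "finite J" for J P
    by (rule cylinderI[OF that]) auto
  then show "?b ` (?F \<times> ?F) \<subseteq> cylinders" by auto
  fix U :: "(int \<Rightarrow> bool) set" and x assume U: "open U" "x \<in> U"
  then obtain J where J: "finite J" "{y. \<forall>k\<in>J. y k = x k} \<subseteq> U" by (rule cylinder_neighbourhood)
  then have "?b (J, {k\<in>J. x k}) \<subseteq> U" by auto
  moreover have "x \<in> ?b (J, {k\<in>J. x k})" by auto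
  moreover have "?b (J, {k\<in>J. x k}) \<in> ?b ` (?F \<times> ?F)" using J(1) by (intro imageI) auto
  ultimately show "\<exists>B\<in>?b ` (?F \<times> ?F). x \<in> B \<and> B \<subseteq> U"
    by (intro bexI[of _ "?b (J, {k\<in>J. x k})"] conjI)
qed

lemma sigma_sets_cylinders: "sigma_sets UNIV cylinders = sigma_sets UNIV {U. open U}"
proof (rule antisym; rule sigma_sets_mono)
  have "cylinders \<subseteq> {U. open U}" using open_cylinder by blast
  then show "cylinders \<subseteq> sigma_sets UNIV {U. open U}" by (rule order_trans) (rule sigma_sets_superset_generator)
next
  obtain \<B> where B: "countable \<B>" "\<B> \<subseteq> cylinders"
    "\<forall>U x. open U \<longrightarrow> x \<in> U \<longrightarrow> (\<exists>B\<in>\<B>. x \<in> B \<and> B \<subseteq> U)"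
    using countable_cylinder_base by (elim exE conjE)
  show "{U. open U} \<subseteq> sigma_sets UNIV cylinders"
  proof
    fix U :: "(int \<Rightarrow> bool) set" assume "U \<in> {U. open U}"
    then have "open U" by (rule CollectD)
    then have U: "U = \<Union>{B\<in>\<B>. B \<subseteq> U}" using B(3)[rule_format, of U] by fast
    have "\<Union>{B\<in>\<B>. B \<subseteq> U} \<in> sigma_sets UNIV cylinders"
    proof (rule sigma_sets_UNION)
      show "countable {B\<in>\<B>. B \<subseteq> U}" by (rule countable_subset[OF _ B(1)]) auto
      show "b \<in> sigma_sets UNIV cylinders" if "b \<in> {B\<in>\<B>. B \<subseteq> U}" for b
        using that B(2) by (intro sigma_sets.Basic) auto
    qed
    then show "U \<in> sigma_sets UNIV cylinders" using U by (rule back_subst[of "\<lambda>V. V \<in> _", OF _ sym])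
  qed
qed

lemma compact_bool_sequences: "compact (UNIV :: (int \<Rightarrow> bool) set)"
proof -
  have "compactin (product_topology (\<lambda>_ :: int. euclidean :: bool topology) UNIV) (PiE UNIV (\<lambda>_. UNIV))"
    unfolding compactin_PiE by (auto intro: finite_imp_compact)
  then show ?thesis by (simp add: euclidean_product_topology)
qed

text \<open>
  Cylinders are closed in a compact space. As a consequence, countable additivity of a
  content on them is automatic: a decreasing sequence with empty intersection is
  eventually empty.
\<close>

lemma decseq_cylinders_empty:
  assumes "range A \<subseteq> cylinders" "decseq A" "(\<Inter>i. A i) = {}"
  shows "\<exists>n. A n = {}"
proof (rule ccontr)
  assume ne: "\<nexists>n. A n = {}"
  have "UNIV \<inter> (\<Inter>i\<in>UNIV. A i) \<noteq> {}"
  proof (rule compact_imp_fip_image[OF compact_bool_sequences])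
    show "closed (A i)" for i using assms(1) closed_cylinder by blast
    fix I :: "nat set" assume "finite I"
    then have "A (Max I) \<subseteq> A i" if "i \<in> I" for i
      using assms(2) that by (auto simp: decseq_def)
    then show "UNIV \<inter> \<Inter> (A ` I) \<noteq> {}" using ne by blast
  qed
  then show False using assms(3) by simp
qed

lemma measure_of_cylinder_content:
  fixes \<nu> :: "(int \<Rightarrow> bool) set \<Rightarrow> real"
  assumes nonneg: "\<And>C. 0 \<le> \<nu> C"
    and add: "\<And>C D. C \<inter> D = {} \<Longrightarrow> \<nu> (C \<union> D) = \<nu> C + \<nu> D"
  obtains \<mu> where "space \<mu> = UNIV" "sets \<mu> = sigma_sets UNIV cylinders"
    "\<And>C. C \<in> cylinders \<Longrightarrow> emeasure \<mu> C = ennreal (\<nu> C)"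
proof -
  interpret algebra UNIV cylinders by (rule cylinder_algebra)
  have e: "\<nu> {} = 0" using add[of "{}" "{}"] by simp
  have "\<exists>m. (\<forall>C\<in>cylinders. m C = ennreal (\<nu> C)) \<and> measure_space UNIV (sigma_sets UNIV cylinders) m"
  proof (rule caratheodory_empty_continuous)
    show "positive cylinders (\<lambda>C. ennreal (\<nu> C))" by (simp add: positive_def e)
    show "additive cylinders (\<lambda>C. ennreal (\<nu> C))"
      using add nonneg by (simp add: additive_def ennreal_plus)
    show "ennreal (\<nu> C) \<noteq> \<infinity>" for C by simp
    fix A :: "nat \<Rightarrow> (int \<Rightarrow> bool) set"
    assume A: "range A \<subseteq> cylinders" "decseq A" "(\<Inter>i. A i) = {}"
    then obtain n where "A n = {}" using decseq_cylinders_empty by blast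
    then have "A i = {}" if "n \<le> i" for i using A(2) that by (auto simp: decseq_def)
    then have "eventually (\<lambda>i. ennreal (\<nu> (A i)) = 0) sequentially"
      unfolding eventually_sequentially by (intro exI[of _ n]) (auto simp: e)
    then show "(\<lambda>i. ennreal (\<nu> (A i))) \<longlonglongrightarrow> 0" by (rule tendsto_eventually)
  qed
  then obtain m where m: "\<And>C. C \<in> cylinders \<Longrightarrow> m C = ennreal (\<nu> C)"
    "measure_space UNIV (sigma_sets UNIV cylinders) m" by blast
  let ?\<mu> = "measure_of UNIV (sigma_sets UNIV cylinders) m"
  have sets: "sets ?\<mu> = sigma_sets UNIV cylinders"
    by (simp add: sigma_sets_sigma_sets_eq)
  have "emeasure ?\<mu> C = ennreal (\<nu> C)" if "C \<in> cylinders" for C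
  proof -
    have "emeasure ?\<mu> C = m C"
      using m(2) that by (intro emeasure_measure_of_sigma) (auto simp: measure_space_def)
    then show ?thesis using m(1)[OF that] by simp
  qed
  then show ?thesis using that[of ?\<mu>] sets by (simp add: space_measure_of_conv)
qed

text \<open>
  The shift and its inverse permute the generating cylinders.
\<close>

lemma shift_measurable:
  assumes "space \<mu> = UNIV" "sets \<mu> = sigma_sets UNIV cylinders"
  shows "left_shift \<in> measurable \<mu> \<mu>" "A \<in> sets \<mu> \<Longrightarrow> left_shift ` A \<in> sets \<mu>"
proof -
  show "left_shift \<in> measurable \<mu> \<mu>"
  proof (rule measurable_sigma_sets[OF assms(2)])
    show "left_shift -` C \<inter> space \<mu> \<in> sets \<mu>" if "C \<in> cylinders" for C
      using cylinder_shift_vimage[OF that] assms by (simp add: sigma_sets.Basic)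
  qed simp_all
  have iv: "inv left_shift -` C = left_shift ` C" for C
    using bij_vimage_eq_inv_image[OF bij_imp_bij_inv[OF bij_left_shift]] bij_left_shift by (simp add: inv_inv_eq)
  have "inv left_shift \<in> measurable \<mu> \<mu>"
  proof (rule measurable_sigma_sets[OF assms(2)])
    show "inv left_shift -` C \<inter> space \<mu> \<in> sets \<mu>" if "C \<in> cylinders" for C
      using cylinder_shift_image[OF that] assms by (simp add: sigma_sets.Basic iv)
  qed simp_all
  then show "A \<in> sets \<mu> \<Longrightarrow> left_shift ` A \<in> sets \<mu>"
    using measurable_sets[of "inv left_shift" \<mu> \<mu> A] assms(1) by (simp add: iv)
qed

lemma shift_measure_preserving:
  assumes mu: "space \<mu> = UNIV" "sets \<mu> = sigma_sets UNIV cylinders" "finite_measure \<mu>"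
    and inv: "\<And>C. C \<in> cylinders \<Longrightarrow> emeasure \<mu> (left_shift -` C) = emeasure \<mu> C"
    and A: "A \<in> sets \<mu>"
  shows "emeasure \<mu> (left_shift -` A) = emeasure \<mu> A"
proof -
  interpret finite_measure \<mu> by fact
  interpret algebra UNIV cylinders by (rule cylinder_algebra)
  note m = shift_measurable(1)[OF mu(1,2)]
  have d: "emeasure (distr \<mu> \<mu> left_shift) A = emeasure \<mu> (left_shift -` A)" if "A \<in> sets \<mu>" for A
    using m that mu(1) by (simp add: emeasure_distr)
  have "distr \<mu> \<mu> left_shift = \<mu>"
  proof (rule measure_eqI_generator_eq[where E=cylinders and \<Omega>=UNIV and A="\<lambda>_. UNIV"])
    show "Int_stable cylinders" by (rule Int_stable)
    show "emeasure (distr \<mu> \<mu> left_shift) X = emeasure \<mu> X" if "X \<in> cylinders" for X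
      using that inv d mu(2) by (simp add: sigma_sets.Basic)
    show "emeasure (distr \<mu> \<mu> left_shift) UNIV \<noteq> \<infinity>"
      using d[of UNIV] mu(1) sets.top[of \<mu>] by simp
  qed (use mu in auto)
  then show ?thesis using d[OF A] by simp
qed

text \<open>
  By Tychonoff's theorem the functions \<open>m N\<close> have a cluster point in the compact product
  of copies of \<open>{0..1}\<close>. Refining the filter instead of extracting a subsequence makes
  \<open>m N C\<close> converge for all \<open>C\<close> simultaneously.
\<close>

lemma filter_of_pointwise_convergence:
  fixes m :: "nat \<Rightarrow> 's \<Rightarrow> real"
  assumes inf: "infinite I" and bound: "\<And>N C. m N C \<in> {0..1}"
  obtains \<nu> G where "G \<noteq> bot" "G \<le> sequentially" "eventually (\<lambda>N. N \<in> I) G"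
    "\<And>C. ((\<lambda>N. m N C) \<longlongrightarrow> \<nu> C) G"
proof -
  define F where "F = inf sequentially (principal I)"
  have F: "F \<noteq> bot"
  proof
    assume "F = bot"
    then have "eventually (\<lambda>_. False) F" by simp
    then have "eventually (\<lambda>N. N \<notin> I) sequentially"
      by (simp add: F_def eventually_inf_principal)
    then show False using inf by (simp add: cofinite_eq_sequentially[symmetric] eventually_cofinite)
  qed
  have "compactin (product_topology (\<lambda>_ :: 's. euclidean :: real topology) UNIV) (PiE UNIV (\<lambda>_. {0..1}))"
    unfolding compactin_PiE by auto
  then have K: "compact (PiE UNIV (\<lambda>_ :: 's. {0..1 :: real}))" by (simp add: euclidean_product_topology)
  have "filtermap m F \<noteq> bot" using F by (simp add: filtermap_bot_iff)
  moreover have "eventually (\<lambda>v. v \<in> PiE UNIV (\<lambda>_. {0..1})) (filtermap m F)"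
    using bound by (simp add: eventually_filtermap PiE_iff)
  ultimately obtain \<nu> where nu: "inf (nhds \<nu>) (filtermap m F) \<noteq> bot"
    using K[unfolded compact_filter] by blast
  define G where "G = inf F (filtercomap m (nhds \<nu>))"
  have "G \<noteq> bot"
  proof
    assume "G = bot"
    then have "eventually (\<lambda>_. False) (inf F (filtercomap m (nhds \<nu>)))" by (simp add: G_def)
    then obtain P Q where PQ: "eventually P F" "eventually Q (filtercomap m (nhds \<nu>))"
      "\<And>N. P N \<Longrightarrow> Q N \<Longrightarrow> False"
      unfolding eventually_inf by blast
    then obtain R where R: "eventually R (nhds \<nu>)" "\<And>N. R (m N) \<Longrightarrow> Q N"
      unfolding eventually_filtercomap by blast
    have "eventually (\<lambda>v. \<not> R v) (filtermap m F)"
      unfolding eventually_filtermap using PQ(1) by (rule eventually_mono) (use PQ(3) R(2) in blast)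
    then have "eventually (\<lambda>_. False) (inf (nhds \<nu>) (filtermap m F))"
      unfolding eventually_inf using R(1) by blast
    then show False using nu by (simp add: trivial_limit_def)
  qed
  moreover have "G \<le> sequentially" by (simp add: G_def F_def le_infI1)
  moreover have "eventually (\<lambda>N. N \<in> I) G"
  proof (rule filter_leD)
    show "G \<le> F" by (simp add: G_def)
    show "eventually (\<lambda>N. N \<in> I) F" by (simp add: F_def eventually_inf_principal)
  qed
  moreover have "((\<lambda>N. m N C) \<longlongrightarrow> \<nu> C) G" for C
  proof -
    have "filterlim m (nhds \<nu>) G"
      by (simp add: filterlim_iff_le_filtercomap G_def)
    from continuous_on_tendsto_compose[OF continuous_on_product_coordinates[of C] this]
    show ?thesis by simp
  qed
  ultimately show ?thesis by (rule that)
qed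

text \<open>
  The recurrence hypothesis speaks about systems on sets of real numbers. The full shift
  has the cardinality of the continuum, and a bijection carries its topology over along
  with its measure; the resulting topology on \<open>UNIV :: real set\<close> is unrelated to the usual
  one.
\<close>

lemma transport_shift_system_to_reals:
  fixes \<mu> :: "(int \<Rightarrow> bool) measure"
  assumes mu: "space \<mu> = UNIV" "sets \<mu> = sigma_sets UNIV cylinders" "emeasure \<mu> UNIV = 1"
    and inv: "\<And>A. A \<in> sets \<mu> \<Longrightarrow> emeasure \<mu> (left_shift -` A) = emeasure \<mu> A"
    and h: "bij (h :: (int \<Rightarrow> bool) \<Rightarrow> real)"
  shows "measure_preserving_system (embed_measure \<mu> h) (h \<circ> left_shift \<circ> the_inv h)"
proof -
  let ?M = "embed_measure \<mu> h" and ?e = "the_inv h" and ?T = "h \<circ> left_shift \<circ> the_inv h"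
  have inj: "inj h" and surj: "range h = UNIV" using h by (auto simp: bij_def)
  have eh [simp]: "?e (h x) = x" for x using inj by (rule the_inv_f_f)
  have he [simp]: "h (?e r) = r" for r using surj by (metis f_the_inv_into_f inj UNIV_I)
  have ebij: "bij ?e" using h by (rule bij_betw_the_inv_into)
  have eimg: "?e -` A = h ` A" for A by (metis (no_types) eh he bij_vimage_eq_inv_image[OF ebij] inv_unique_comp image_cong inv_equality)
  have sp: "space ?M = UNIV" using mu surj by (simp add: space_embed_measure)
  have st: "sets ?M = (`) h ` sets \<mu>" using inj by (rule sets_embed_measure_alt)
  have em: "emeasure ?M (h ` A) = emeasure \<mu> A" if "A \<in> sets \<mu>" for A
    using inj that by (rule emeasure_embed_measure_image)
  have vimg: "?T -` (h ` A) = h ` (left_shift -` A)" for A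
  proof (rule set_eqI)
    fix r
    have "r \<in> ?T -` (h ` A) \<longleftrightarrow> left_shift (?e r) \<in> A" using inj by (auto simp: inj_image_mem_iff)
    also have "\<dots> \<longleftrightarrow> r \<in> h ` (left_shift -` A)" by (metis eh he imageE imageI vimage_eq)
    finally show "r \<in> ?T -` (h ` A) \<longleftrightarrow> r \<in> h ` (left_shift -` A)" .
  qed
  note sm = shift_measurable[OF mu(1,2)]
  have bijT: "bij ?T" using h bij_left_shift ebij by (intro bij_comp)
  have Timg: "?T ` (h ` A) = h ` (left_shift ` A)" for A by (auto simp: image_image)
  have euc: "completely_metrizable_space (euclidean :: (int \<Rightarrow> bool) topology)"
  proof -
    have "(euclidean :: bool topology) = discrete_topology UNIV"
      by (simp add: topology_eq discrete_topology_class.open_discrete)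
    then have "completely_metrizable_space (product_topology (\<lambda>_ :: int. euclidean :: bool topology) UNIV)"
      by (simp add: completely_metrizable_space_product_topology completely_metrizable_space_discrete_topology)
    then show ?thesis by (simp add: euclidean_product_topology)
  qed
  have sc: "second_countable (euclidean :: (int \<Rightarrow> bool) topology)"
  proof -
    obtain \<B> where "countable \<B>" "\<B> \<subseteq> cylinders"
      "\<forall>U x. open U \<longrightarrow> x \<in> U \<longrightarrow> (\<exists>B\<in>\<B>. x \<in> B \<and> B \<subseteq> U)"
      using countable_cylinder_base by (elim exE conjE)
    then show ?thesis unfolding second_countable_def
      using open_cylinder by (intro exI[of _ \<B>]) auto
  qed
  let ?S = "pullback_topology UNIV ?e euclidean"
  have topS: "topspace ?S = UNIV" by (simp add: topspace_pullback_topology)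
  have opS: "openin ?S V \<longleftrightarrow> (\<exists>U. open U \<and> V = h ` U)" for V
    by (simp add: openin_pullback_topology eimg)
  have "homeomorphic_map ?S euclidean ?e"
  proof (rule bijective_open_imp_homeomorphic_map)
    show "continuous_map ?S euclidean ?e"
      by (auto simp: continuous_map_def topS openin_pullback_topology)
    show "open_map ?S euclidean ?e" by (auto simp: open_map_def opS image_image)
    show "?e ` topspace ?S = topspace euclidean" using ebij by (simp add: topS bij_def)
    show "inj_on ?e (topspace ?S)" using ebij by (simp add: topS bij_def)
  qed
  then have hs: "?S homeomorphic_space (euclidean :: (int \<Rightarrow> bool) topology)"
    by (rule homeomorphic_map_imp_homeomorphic_space)
  have "sets ?M = sigma_sets UNIV {V. openin ?S V}"
  proof -
    have "(`) h ` sigma_sets UNIV {U. open U} = sigma_sets UNIV ((`) h ` {U. open U})"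
    proof -
      have "{?e -` A \<inter> UNIV |A. A \<in> sigma_sets UNIV {U. open U}} = sigma_sets UNIV {?e -` A \<inter> UNIV |A. A \<in> {U. open U}}"
        by (rule sigma_sets_vimage_commute) auto
      moreover have "{?e -` A \<inter> UNIV |A. A \<in> X} = (`) h ` X" for X by (auto simp: eimg)
      ultimately show ?thesis by (simp only:)
    qed
    moreover have "(`) h ` {U. open U} = {V. openin ?S V}" by (auto simp: opS)
    ultimately show ?thesis by (simp only: st mu(2) sigma_sets_cylinders)
  qed
  then have "standard_borel ?M"
    unfolding standard_borel_def
    using homeomorphic_completely_metrizable_space[OF hs] homeomorphic_space_second_countability[OF hs]
      euc sc sp topS
    by (intro exI[of _ ?S]) auto
  moreover have "prob_space ?M"
  proof
    have "emeasure ?M (h ` UNIV) = 1" using em[of UNIV] mu sets.top[of \<mu>] by simp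
    then show "emeasure ?M (space ?M) = 1" using sp surj by simp
  qed
  moreover have "?T \<in> measurable ?M ?M"
  proof (rule measurableI)
    fix B assume "B \<in> sets ?M"
    then obtain A where A: "A \<in> sets \<mu>" "B = h ` A" using st by auto
    have "left_shift -` A \<in> sets \<mu>" using measurable_sets[OF sm(1) A(1)] mu(1) by simp
    then show "?T -` B \<inter> space ?M \<in> sets ?M" unfolding A(2) vimg sp using st by auto
  qed (simp add: sp)
  moreover have "the_inv_into (space ?M) ?T \<in> measurable ?M ?M"
  proof (rule measurableI)
    fix B assume "B \<in> sets ?M"
    then obtain A where A: "A \<in> sets \<mu>" "B = h ` A" using st by auto
    have "the_inv ?T -` B = ?T ` B"
    proof (rule set_eqI)
      fix r
      obtain s where s: "r = ?T s" using bij_is_surj[OF bijT] by (rule surjE)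
      show "r \<in> the_inv ?T -` B \<longleftrightarrow> r \<in> ?T ` B"
        unfolding s using bij_is_inj[OF bijT] by (simp only: vimage_eq the_inv_f_f inj_image_mem_iff)
    qed
    then show "the_inv_into (space ?M) ?T -` B \<inter> space ?M \<in> sets ?M"
      unfolding sp A(2) using st sm(2)[OF A(1)] by (simp add: Timg del: o_apply)
  qed (simp add: sp)
  moreover have "emeasure ?M (?T -` B \<inter> space ?M) = emeasure ?M B" if B: "B \<in> sets ?M" for B
  proof -
    obtain A where A: "A \<in> sets \<mu>" "B = h ` A" using B st by auto
    have "left_shift -` A \<in> sets \<mu>" using measurable_sets[OF sm(1) A(1)] mu(1) by simp
    then show ?thesis unfolding A(2) vimg sp using em A(1) inv[OF A(1)] by simp
  qed
  moreover have "bij_betw ?T (space ?M) (space ?M)" using bijT by (simp only: sp)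
  ultimately show ?thesis
    unfolding measure_preserving_system_def by (intro conjI ballI)
qed

text \<open>
  Averages of a sequence that is zero from some point on tend to \<open>0\<close>.
\<close>

lemma nonzero_term_of_positive_liminf_average:
  fixes f :: "nat \<Rightarrow> real"
  assumes "0 < liminf (\<lambda>N. ereal (1 / real N * (\<Sum>n=1..N. f n)))"
  shows "\<exists>n>n0. f n \<noteq> 0"
proof (rule ccontr)
  assume "\<not> ?thesis"
  then have z: "f n = 0" if "n0 < n" for n using that by blast
  define s where "s = (\<Sum>n=1..n0. f n)"
  have "(\<Sum>n=1..N. f n) = s" if "n0 \<le> N" for N
    unfolding s_def using that z by (intro sum.mono_neutral_right) auto
  then have ev: "eventually (\<lambda>N. 1 / real N * (\<Sum>n=1..N. f n) = 1 / real N * s) sequentially"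
    unfolding eventually_sequentially by (intro exI[of _ n0]) simp
  have "(\<lambda>N. 1 / real N * s) \<longlonglongrightarrow> 0 * s"
    by (intro tendsto_mult lim_1_over_n tendsto_const)
  then have "(\<lambda>N. 1 / real N * (\<Sum>n=1..N. f n)) \<longlonglongrightarrow> 0"
    unfolding mult_zero_left using tendsto_cong[OF ev] by (rule iffD2[rotated])
  then have "(\<lambda>N. ereal (1 / real N * (\<Sum>n=1..N. f n))) \<longlonglongrightarrow> ereal 0"
    by simp
  then have "liminf (\<lambda>N. ereal (1 / real N * (\<Sum>n=1..N. f n))) = 0"
    using lim_imp_Liminf[OF sequentially_bot] by (simp only: zero_ereal_def)
  then show False using assms by simp
qed

lemma recurrence_of_shift_measure:
  fixes \<mu> :: "(int \<Rightarrow> bool) measure"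
  assumes l: "1 \<le> l" and good: "good_for_liminf_recurrence l a"
    and mu: "space \<mu> = UNIV" "sets \<mu> = sigma_sets UNIV cylinders" "emeasure \<mu> UNIV = 1"
    and inv: "\<And>A. A \<in> sets \<mu> \<Longrightarrow> emeasure \<mu> (left_shift -` A) = emeasure \<mu> A"
    and pos: "0 < measure \<mu> {x. x 0}"
  shows "\<exists>n>n0. 0 < measure \<mu> {x. x 0 \<and> (\<forall>i\<in>{1..l}. x (int (a i n)))}"
proof -
  obtain f :: "nat set \<Rightarrow> real" where f: "bij f"
    using nat_sets_eqpoll_reals unfolding eqpoll_def by blast
  have "bij (\<lambda>x :: int \<Rightarrow> bool. int_encode ` {k. x k})"
  proof (rule o_bij[of "\<lambda>S k. int_encode k \<in> S"])
    have "int_encode ` {k. int_encode k \<in> S} = S" for S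
      using bij_is_surj[OF bij_int_encode] by (metis Collect_mem_eq image_vimage_eq inf_top.right_neutral vimage_def)
    then show "(\<lambda>x. int_encode ` {k. x k}) \<circ> (\<lambda>S k. int_encode k \<in> S) = id" by auto
    show "(\<lambda>S k. int_encode k \<in> S) \<circ> (\<lambda>x. int_encode ` {k. x k}) = id"
      by (simp add: fun_eq_iff inj_image_mem_iff[OF bij_is_inj[OF bij_int_encode]])
  qed
  then have "bij (f \<circ> (\<lambda>x. int_encode ` {k. x k}))" using f by (rule bij_comp)
  then obtain h :: "(int \<Rightarrow> bool) \<Rightarrow> real" where h: "bij h" by blast
  then have inj: "inj h" and surj: "range h = UNIV" by (auto simp: bij_def)
  let ?M = "embed_measure \<mu> h" and ?T = "h \<circ> left_shift \<circ> the_inv h"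
  have sys: "measure_preserving_system ?M ?T" by (rule transport_shift_system_to_reals[OF mu inv h])
  have one: "{x. x 0} \<in> sets \<mu>"
    unfolding mu(2) by (intro sigma_sets.Basic cylinderI[of "{0}"]) auto
  have ms: "measure ?M (h ` A) = measure \<mu> A" if "A \<in> sets \<mu>" for A
    using emeasure_embed_measure_image[OF inj that] by (simp add: measure_def)
  have Tn: "(?T ^^ n) (h x) = h ((left_shift ^^ n) x)" for n x
    using inj by (induction n) (simp_all add: the_inv_f_f)
  let ?R = "\<lambda>n. {x. x 0 \<and> (\<forall>i\<in>{1..l}. x (int (a i n)))}"
  have R: "h ` {x. x 0} \<inter> (\<Inter>i\<in>{1..l}. (?T ^^ a i n) -` (h ` {x. x 0}) \<inter> space ?M) = h ` ?R n" for n
  proof (rule set_eqI)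
    fix r
    obtain x where x: "r = h x" using surj by (metis surjD)
    have sp: "space ?M = UNIV" using mu surj by (simp add: space_embed_measure)
    show "r \<in> h ` {x. x 0} \<inter> (\<Inter>i\<in>{1..l}. (?T ^^ a i n) -` (h ` {x. x 0}) \<inter> space ?M) \<longleftrightarrow> r \<in> h ` ?R n"
      unfolding x sp by (simp add: Tn inj_image_mem_iff[OF inj] left_shift_power del: o_apply)
  qed
  have Rs: "?R n \<in> sets \<mu>" for n
    unfolding mu(2)
    by (intro sigma_sets.Basic cylinderI[of "insert 0 ((\<lambda>i. int (a i n)) ` {1..l})"]) auto
  have "0 < liminf (\<lambda>N. ereal (1 / real N *
      (\<Sum>n=1..N. measure ?M (h ` {x. x 0} \<inter> (\<Inter>i\<in>{1..l}. (?T ^^ a i n) -` (h ` {x. x 0}) \<inter> space ?M)))))"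
    using good[unfolded good_for_liminf_recurrence_def, rule_format, OF sys, of "h ` {x. x 0}"]
      in_sets_embed_measure[OF one, of h] ms[OF one] pos by simp
  then have "0 < liminf (\<lambda>N. ereal (1 / real N * (\<Sum>n=1..N. measure \<mu> (?R n))))"
    by (simp only: R ms[OF Rs])
  from nonzero_term_of_positive_liminf_average[OF this, of n0] show ?thesis
    by (metis (no_types, lifting) measure_nonneg order_less_le)
qed


text \<open>
  The measure of a cylinder is the limiting frequency of times at which the shifted set
  \<open>F N\<close> shows the corresponding pattern. Invariance holds in the limit since the sums for
  a cylinder and its shifted copy differ by two boundary terms. Positive measure of
  \<open>x 0 \<and> x (a 1 n) \<and> \<dots> \<and> x (a l n)\<close> therefore means that for many \<open>N\<close> the set of \<open>j \<in> F N\<close>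
  with all \<open>j + a i n \<in> F N\<close> is dense.
\<close>

theorem recurrence_of_dense_sets:
  fixes F :: "nat \<Rightarrow> nat set"
  assumes l: "1 \<le> l" and good: "good_for_liminf_recurrence l a"
    and I: "infinite I" and c: "0 < c"
    and F: "\<And>N. N \<in> I \<Longrightarrow> F N \<subseteq> {..<N}" "\<And>N. N \<in> I \<Longrightarrow> c * real N \<le> real (card (F N))"
  shows "\<exists>n>n0. \<exists>c'>0. infinite {N\<in>I. c' * real N \<le> real (card {j\<in>F N. \<forall>i\<in>{1..l}. j + a i n \<in> F N})}"
proof -
  \<comment> \<open>the indicator sequence of \<open>F N\<close>, shifted by \<open>j\<close> and extended by \<open>False\<close> to negative
    arguments\<close>
  define pt where "pt N j = (\<lambda>k::int. 0 \<le> k + int j \<and> nat (k + int j) \<in> F N)" for N j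
  have shift_pt: "left_shift (pt N j) = pt N (Suc j)" for N j
    by (simp add: left_shift_def pt_def algebra_simps)
  define m where "m N C = (\<Sum>j<N. of_bool (pt N j \<in> C)) / real N" for N C
  have m01: "m N C \<in> {0..1}" for N C
  proof -
    have "(\<Sum>j<N. of_bool (pt N j \<in> C) :: real) \<le> (\<Sum>j<N. 1)" by (rule sum_mono) simp
    moreover have "0 \<le> (\<Sum>j<N. of_bool (pt N j \<in> C) :: real)" by (rule sum_nonneg) simp
    ultimately show ?thesis unfolding m_def by (simp add: divide_le_eq)
  qed
  obtain \<nu> G where G: "G \<noteq> bot" "G \<le> sequentially" "eventually (\<lambda>N. N \<in> I) G"
    and nu: "\<And>C. ((\<lambda>N. m N C) \<longlongrightarrow> \<nu> C) G"
    using filter_of_pointwise_convergence[of I m, OF I m01] by blast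
  have nonneg: "0 \<le> \<nu> C" for C
    using m01 by (intro tendsto_lowerbound[OF nu _ G(1)]) auto
  have add: "\<nu> (C \<union> D) = \<nu> C + \<nu> D" if "C \<inter> D = {}" for C D
  proof -
    have "m N (C \<union> D) = m N C + m N D" for N
    proof -
      have "of_bool (pt N j \<in> C \<union> D) = (of_bool (pt N j \<in> C) + of_bool (pt N j \<in> D) :: real)" for j
        using that by auto
      then show ?thesis by (simp only: m_def sum.distrib add_divide_distrib)
    qed
    then have "((\<lambda>N. m N C + m N D) \<longlongrightarrow> \<nu> (C \<union> D)) G" using nu[of "C \<union> D"] by simp
    then show ?thesis using tendsto_unique[OF G(1)] tendsto_add[OF nu nu] by blast
  qed
  have ev1: "eventually (\<lambda>N. 1 \<le> N) G"
    using G(2) eventually_ge_at_top by (rule filter_leD)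
  have total: "\<nu> UNIV = 1"
  proof -
    have "eventually (\<lambda>N. m N UNIV = 1) G"
      using ev1 by (rule eventually_mono) (simp add: m_def)
    then have "((\<lambda>N. m N UNIV) \<longlongrightarrow> 1) G" by (rule tendsto_eventually)
    then show ?thesis using tendsto_unique[OF G(1) nu] by blast
  qed
  have shift_inv: "\<nu> (left_shift -` C) = \<nu> C" for C
  proof -
    have "\<bar>m N (left_shift -` C) - m N C\<bar> \<le> 1 / real N" for N
    proof -
      have "m N (left_shift -` C) - m N C = (\<Sum>j<N. of_bool (pt N (Suc j) \<in> C) - of_bool (pt N j \<in> C)) / real N"
        by (simp add: m_def shift_pt sum_subtractf diff_divide_distrib)
      also have "\<dots> = (of_bool (pt N N \<in> C) - of_bool (pt N 0 \<in> C)) / real N"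
        by (simp only: sum_lessThan_telescope[of "\<lambda>j. of_bool (pt N j \<in> C)"])
      finally have eq: "m N (left_shift -` C) - m N C = (of_bool (pt N N \<in> C) - of_bool (pt N 0 \<in> C)) / real N" .
      show ?thesis unfolding eq by (simp add: of_bool_def)
    qed
    moreover have "((\<lambda>N. 1 / real N) \<longlongrightarrow> 0) G"
      using lim_1_over_n G(2) by (rule tendsto_mono[rotated])
    ultimately have "((\<lambda>N. m N (left_shift -` C) - m N C) \<longlongrightarrow> 0) G"
      by (intro Lim_null_comparison[of "\<lambda>N. m N (left_shift -` C) - m N C" "\<lambda>N. 1 / real N"]) auto
    moreover have "((\<lambda>N. m N (left_shift -` C) - m N C) \<longlongrightarrow> \<nu> (left_shift -` C) - \<nu> C) G"
      by (intro tendsto_diff nu)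
    ultimately show ?thesis using tendsto_unique[OF G(1)] by fastforce
  qed
  obtain \<mu> where mu: "space \<mu> = UNIV" "sets \<mu> = sigma_sets UNIV cylinders"
    "\<And>C. C \<in> cylinders \<Longrightarrow> emeasure \<mu> C = ennreal (\<nu> C)"
    using measure_of_cylinder_content[of \<nu>, OF nonneg add] by blast
  have "UNIV \<in> cylinders" by (rule cylinderI[of "{}"]) auto
  then have mu1: "emeasure \<mu> UNIV = 1" using mu(3) total by simp
  have "finite_measure \<mu>" by (rule finite_measureI) (simp add: mu(1) mu1)
  moreover have "emeasure \<mu> (left_shift -` C) = emeasure \<mu> C" if "C \<in> cylinders" for C
    using mu(3)[OF that] mu(3)[OF cylinder_shift_vimage[OF that]] shift_inv by simp
  ultimately have mu_inv: "emeasure \<mu> (left_shift -` A) = emeasure \<mu> A" if "A \<in> sets \<mu>" for A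
    using that by (rule shift_measure_preserving[OF mu(1,2)])
  have meas: "measure \<mu> C = \<nu> C" if "C \<in> cylinders" for C
    using mu(3)[OF that] nonneg by (simp add: measure_def)
  have one: "{x. x 0} \<in> cylinders" by (rule cylinderI[of "{0}"]) auto
  have "c \<le> \<nu> {x. x 0}"
  proof (rule tendsto_lowerbound[OF nu _ G(1)])
    show "eventually (\<lambda>N. c \<le> m N {x. x 0}) G"
      using ev1 G(3)
    proof eventually_elim
      case (elim N)
      have "m N {x. x 0} = real (card ({..<N} \<inter> F N)) / real N"
        by (simp add: m_def pt_def sum.If_cases of_bool_def Int_def)
      also have "{..<N} \<inter> F N = F N" using F(1)[OF elim(2)] by blast
      finally show ?case using F(2)[OF elim(2)] elim(1) by (simp add: le_divide_eq)
    qed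
  qed
  then have "0 < measure \<mu> {x. x 0}" using c meas[OF one] by simp
  from recurrence_of_shift_measure[OF l good mu(1,2) mu1 mu_inv this, of n0]
  obtain n where n: "n0 < n" "0 < measure \<mu> {x. x 0 \<and> (\<forall>i\<in>{1..l}. x (int (a i n)))}" by blast
  let ?R = "{x. x 0 \<and> (\<forall>i\<in>{1..l}. x (int (a i n)))}"
  let ?F = "\<lambda>N. {j\<in>F N. \<forall>i\<in>{1..l}. j + a i n \<in> F N}"
  have "?R \<in> cylinders"
    by (rule cylinderI[of "insert 0 ((\<lambda>i. int (a i n)) ` {1..l})"]) auto
  then have R0: "0 < \<nu> ?R" using n(2) meas by simp
  define c' where "c' = \<nu> ?R / 2"
  have c': "0 < c'" "c' < \<nu> ?R" using R0 by (simp_all add: c'_def)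
  have evG: "eventually (\<lambda>N. N \<in> {N\<in>I. c' * real N \<le> real (card (?F N))}) G"
    using order_tendstoD(1)[OF nu c'(2)] G(3) ev1
  proof eventually_elim
    case (elim N)
    have "m N ?R = real (card ({..<N} \<inter> ?F N)) / real N"
    proof -
      have "pt N j \<in> ?R \<longleftrightarrow> j \<in> ?F N" for j
        by (simp add: pt_def nat_add_distrib add.commute flip: of_nat_add)
      then have "m N ?R = (\<Sum>j<N. of_bool (j \<in> ?F N)) / real N" by (simp only: m_def)
      also have "(\<Sum>j<N. of_bool (j \<in> ?F N)) = real (card ({..<N} \<inter> ?F N))"
        by (simp add: sum.If_cases of_bool_def Int_def)
      finally show ?thesis .
    qed
    also have "{..<N} \<inter> ?F N = ?F N" using F(1)[OF elim(2)] by blast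
    finally have "m N ?R = real (card (?F N)) / real N" .
    then show ?case using elim by (simp add: less_divide_eq)
  qed
  have "infinite {N\<in>I. c' * real N \<le> real (card (?F N))}"
  proof
    assume "finite {N\<in>I. c' * real N \<le> real (card (?F N))}"
    then have "eventually (\<lambda>N. N \<notin> {N\<in>I. c' * real N \<le> real (card (?F N))}) sequentially"
      unfolding cofinite_eq_sequentially[symmetric] eventually_cofinite by simp
    from eventually_conj[OF filter_leD[OF G(2) this] evG] have "eventually (\<lambda>_. False) G"
      by (rule eventually_mono) blast
    then show False using G(1) by (simp add: trivial_limit_def)
  qed
  then show ?thesis using n(1) c'(1) by blast
qed

section \<open>Dense independence\<close>

definition independence_set :: "'a topology \<Rightarrow> ('a \<Rightarrow> 'a) \<Rightarrow> 's set \<Rightarrow> ('s \<Rightarrow> 'a set) \<Rightarrow> nat set \<Rightarrow> bool" where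
  "independence_set X T S A W \<longleftrightarrow>
     (\<forall>\<sigma>. (\<forall>j\<in>W. \<sigma> j \<in> S) \<longrightarrow> (\<exists>x\<in>topspace X. \<forall>j\<in>W. (T ^^ j) x \<in> A (\<sigma> j)))"

text \<open>
  Infinitely many \<open>N\<close>, as opposed to all large \<open>N\<close>: this is the form of positive density
  that an upper limit (in the entropy of a cover) and a limit point (in the correspondence
  principle) provide.
\<close>

definition densely_independent :: "'a topology \<Rightarrow> ('a \<Rightarrow> 'a) \<Rightarrow> 's set \<Rightarrow> ('s \<Rightarrow> 'a set) \<Rightarrow> bool" where
  "densely_independent X T S A \<longleftrightarrow> (\<exists>c>0. infinite {N. \<exists>W\<subseteq>{..<N}.
     c * real N \<le> real (card W) \<and> independence_set X T S A W})"

lemma densely_independentE: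
  assumes "densely_independent X T S A"
  obtains c I W where "0 < c" "infinite I" "\<forall>N\<in>I. 0 < N \<and> W N \<subseteq> {..<N} \<and> c * real N \<le> real (card (W N)) \<and>
      W N \<noteq> {} \<and> independence_set X T S A (W N)"
proof -
  obtain c where c: "0 < c" and inf: "infinite {N. \<exists>W\<subseteq>{..<N}. c * real N \<le> real (card W) \<and> independence_set X T S A W}"
    using assms unfolding densely_independent_def by blast
  define I where "I = {N. \<exists>W\<subseteq>{..<N}. c * real N \<le> real (card W) \<and> independence_set X T S A W} - {0}"
  have I: "infinite I" using inf by (simp add: I_def)
  have "\<forall>N\<in>I. \<exists>W. W \<subseteq> {..<N} \<and> c * real N \<le> real (card W) \<and> independence_set X T S A W"
    by (auto simp: I_def)
  then obtain W where W: "\<forall>N\<in>I. W N \<subseteq> {..<N} \<and> c * real N \<le> real (card (W N)) \<and> independence_set X T S A (W N)"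
    by (rule bchoice[THEN exE])
  have pos: "0 < N" if "N \<in> I" for N using that by (auto simp: I_def)
  have ne: "W N \<noteq> {}" if "N \<in> I" for N
  proof
    assume "W N = {}"
    then have "c * real N \<le> 0" using W that by fastforce
    then show False using c pos[OF that] by (simp add: mult_le_0_iff)
  qed
  show ?thesis using that[of c I W] c I W pos ne by blast
qed

lemma densely_independentI:
  assumes "0 < c" "infinite I"
    "\<And>N. N \<in> I \<Longrightarrow> \<exists>W\<subseteq>{..<N}. c * real N \<le> real (card W) \<and> independence_set X T S A W"
  shows "densely_independent X T S A"
  unfolding densely_independent_def
  using assms by (intro exI[of _ c] conjI) (auto elim!: infinite_super[rotated])

text \<open>
  The combinatorial lemmas yield, for each \<open>N\<close>, one of finitely many families; one family
  serves infinitely many \<open>N\<close>.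
\<close>

lemma densely_independent_pigeonhole:
  assumes "0 < c" "infinite I" "finite Q"
    "\<And>N. N \<in> I \<Longrightarrow> \<exists>q\<in>Q. \<exists>W\<subseteq>{..<N}. c * real N \<le> real (card W) \<and> independence_set X T (S q) (A q) W"
  shows "\<exists>q\<in>Q. densely_independent X T (S q) (A q)"
proof -
  obtain q where "q \<in> Q"
    "infinite {N \<in> I. \<exists>W\<subseteq>{..<N}. c * real N \<le> real (card W) \<and> independence_set X T (S q) (A q) W}"
    using pigeonhole_infinite_rel[OF assms(2,3), of "\<lambda>N q. \<exists>W\<subseteq>{..<N}. c * real N \<le> real (card W) \<and> independence_set X T (S q) (A q) W"] assms(4)
    by auto
  then show ?thesis using assms(1) by (intro bexI[of _ q] densely_independentI) auto
qed

lemma funpow_in_topspace: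
  assumes "T \<in> topspace X \<rightarrow> topspace X" "x \<in> topspace X"
  shows "(T ^^ n) x \<in> topspace X"
  using assms by (induction n) auto

lemma densely_independent_nonempty:
  assumes "densely_independent X T S A" "s \<in> S"
  shows "A s \<noteq> {}"
proof -
  obtain c I W where "0 < c" "infinite I"
    "\<forall>N\<in>I. 0 < N \<and> W N \<subseteq> {..<N} \<and> c * real N \<le> real (card (W N)) \<and>
      W N \<noteq> {} \<and> independence_set X T S A (W N)"
    using assms(1) by (rule densely_independentE)
  then obtain N where N: "W N \<noteq> {}" "independence_set X T S A (W N)"
    using infinite_imp_nonempty[of I] by blast
  then obtain j where "j \<in> W N" by blast
  moreover obtain x where "\<forall>j\<in>W N. (T ^^ j) x \<in> A s"
    using N(2)[unfolded independence_set_def, rule_format, of "\<lambda>_. s"] assms(2) by blast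
  ultimately show ?thesis by blast
qed

text \<open>
  Forgetting the indices of a family: the sets in its range serve as their own indices, so
  that the families constructed later all have the same type.
\<close>

lemma independence_set_image:
  assumes "independence_set X T S A W"
  shows "independence_set X T (A ` S) (\<lambda>C. C) W"
  unfolding independence_set_def
proof (intro allI impI)
  fix \<sigma> assume "\<forall>j\<in>W. \<sigma> j \<in> A ` S"
  then have "\<forall>j\<in>W. \<exists>s. s \<in> S \<and> \<sigma> j = A s" by blast
  then obtain t where t: "\<forall>j\<in>W. t j \<in> S \<and> \<sigma> j = A (t j)" by (rule bchoice[THEN exE])
  then obtain x where "x \<in> topspace X" "\<forall>j\<in>W. (T ^^ j) x \<in> A (t j)"
    using assms unfolding independence_set_def by blast
  then show "\<exists>x\<in>topspace X. \<forall>j\<in>W. (T ^^ j) x \<in> \<sigma> j" using t by auto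
qed

lemma densely_independent_image:
  assumes "densely_independent X T S A"
  shows "densely_independent X T (A ` S) (\<lambda>C. C)"
proof -
  obtain c I W where *: "0 < c" "infinite I"
    "\<forall>N\<in>I. 0 < N \<and> W N \<subseteq> {..<N} \<and> c * real N \<le> real (card (W N)) \<and>
      W N \<noteq> {} \<and> independence_set X T S A (W N)"
    using assms by (rule densely_independentE)
  show ?thesis
  proof (rule densely_independentI[OF *(1,2)])
    fix N assume "N \<in> I"
    then show "\<exists>W\<subseteq>{..<N}. c * real N \<le> real (card W) \<and> independence_set X T (A ` S) (\<lambda>C. C) W"
      using *(3) independence_set_image[of X T S A "W N"] by blast
  qed
qed

text \<open>
  For an independence set \<open>J\<close> choose a point for every itinerary \<open>\<sigma> \<in> J \<rightarrow> S\<close>, and record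
  at time \<open>j\<close> the letter \<open>(\<sigma> j, p)\<close>, where \<open>p\<close> is a piece containing the point at that
  time. The patterns are the graphs of functions \<open>S \<rightarrow> R\<close>. A set of letters without a
  pattern misses some element of \<open>S\<close> completely, so a box covers at most
  \<open>(card S - 1) ^ card J\<close> of the \<open>card S ^ card J\<close> itineraries, and the number of boxes
  needed is exponential. A shattered pattern is a choice of pieces with a large
  independence set.
\<close>

lemma densely_independent_refine:
  fixes S :: "'s set" and R :: "'p set" and A :: "'s \<Rightarrow> 'a set"
  assumes S: "finite S" "2 \<le> card S" and R: "finite R"
    and AB: "\<And>s. s \<in> S \<Longrightarrow> A s \<subseteq> (\<Union>p\<in>R. B s p)"
    and dense: "densely_independent X T S A"
  shows "\<exists>p. (\<forall>s\<in>S. p s \<in> R) \<and> densely_independent X T S (\<lambda>s. B s (p s))"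
proof -
  let ?k = "card S"
  have Sne: "S \<noteq> {}" using S by auto
  define graph where "graph p = (\<lambda>s. (s, p s)) ` S" for p :: "'s \<Rightarrow> 'p"
  have R0: "R \<noteq> {}"
    using AB Sne densely_independent_nonempty[OF dense] by fastforce
  interpret pattern_system "S \<times> R" "graph ` (S \<rightarrow>\<^sub>E R)"
  proof
    show "finite (S \<times> R)" using S R by simp
    show "P \<subseteq> S \<times> R" if "P \<in> graph ` (S \<rightarrow>\<^sub>E R)" for P using that by (auto simp: graph_def)
    show "2 \<le> card P" if "P \<in> graph ` (S \<rightarrow>\<^sub>E R)" for P
      using that S by (auto simp: graph_def card_image inj_on_def)
  qed
  define b where "b = real ?k / (real ?k - 1)"
  have b: "1 < b" using S by (simp add: b_def)
  obtain c0 where c0: "0 < c0"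
    and shat: "\<And>(f :: nat \<Rightarrow> (nat \<Rightarrow> 's) \<Rightarrow> 's \<times> 'p) J Y. \<lbrakk>finite J; J \<noteq> {}; \<And>j y. f j y \<in> S \<times> R;
        \<And>\<B>. box_cover f J Y \<B> \<Longrightarrow> b ^ card J \<le> real (card \<B>)\<rbrakk> \<Longrightarrow>
      \<exists>P\<in>graph ` (S \<rightarrow>\<^sub>E R). \<exists>W\<subseteq>J. c0 * real (card J) \<le> real (card W) \<and>
        (\<forall>\<tau>. (\<forall>j\<in>W. \<tau> j \<in> P) \<longrightarrow> (\<exists>y\<in>Y. \<forall>j\<in>W. f j y = \<tau> j))"
    using exponential_cover_shatters[OF b, where 'p="nat \<Rightarrow> 's"] by blast
  obtain c I W where W0: "0 < c" "infinite I"
    "\<forall>N\<in>I. 0 < N \<and> W N \<subseteq> {..<N} \<and> c * real N \<le> real (card (W N)) \<and>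
      W N \<noteq> {} \<and> independence_set X T S A (W N)"
    using dense by (rule densely_independentE)
  note W = W0(1,2) W0(3)[rule_format, THEN conjunct1]
    W0(3)[rule_format, THEN conjunct2, THEN conjunct1]
    W0(3)[rule_format, THEN conjunct2, THEN conjunct2, THEN conjunct1]
    W0(3)[rule_format, THEN conjunct2, THEN conjunct2, THEN conjunct2, THEN conjunct1]
    W0(3)[rule_format, THEN conjunct2, THEN conjunct2, THEN conjunct2, THEN conjunct2]
  have "\<exists>p\<in>S \<rightarrow>\<^sub>E R. densely_independent X T S (\<lambda>s. B s (p s))"
  proof (rule densely_independent_pigeonhole[OF _ W(2)])
    show "0 < c0 * c" using c0 W(1) by simp
    show "finite (S \<rightarrow>\<^sub>E R)" using S R by (simp add: finite_PiE)
    fix N assume N: "N \<in> I"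
    let ?J = "W N"
    let ?Y = "?J \<rightarrow>\<^sub>E S"
    have J: "finite ?J" using W(4)[OF N] finite_subset by blast
    have "\<forall>\<sigma>\<in>?Y. \<exists>x. x \<in> topspace X \<and> (\<forall>j\<in>?J. (T ^^ j) x \<in> A (\<sigma> j))"
    proof
      fix \<sigma> assume "\<sigma> \<in> ?Y"
      then have "\<forall>j\<in>?J. \<sigma> j \<in> S" by (auto dest: PiE_mem)
      then show "\<exists>x. x \<in> topspace X \<and> (\<forall>j\<in>?J. (T ^^ j) x \<in> A (\<sigma> j))"
        using W(7)[OF N] unfolding independence_set_def by blast
    qed
    then obtain x where x: "\<forall>\<sigma>\<in>?Y. x \<sigma> \<in> topspace X \<and> (\<forall>j\<in>?J. (T ^^ j) (x \<sigma>) \<in> A (\<sigma> j))"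
      by (rule bchoice[THEN exE])
    define q where "q \<sigma> j = (SOME p. p \<in> R \<and> (T ^^ j) (x \<sigma>) \<in> B (\<sigma> j) p)" for \<sigma> j
    have q: "q \<sigma> j \<in> R \<and> (T ^^ j) (x \<sigma>) \<in> B (\<sigma> j) (q \<sigma> j)" if "\<sigma> \<in> ?Y" "j \<in> ?J" for \<sigma> j
    proof -
      have "\<sigma> j \<in> S" using that by (auto dest: PiE_mem)
      then have "\<exists>p. p \<in> R \<and> (T ^^ j) (x \<sigma>) \<in> B (\<sigma> j) p" using x that AB by blast
      then show ?thesis unfolding q_def by (rule someI_ex)
    qed
    obtain e where e: "e \<in> S \<times> R" using Sne R0 by blast
    define f where "f j \<sigma> = (if \<sigma> \<in> ?Y \<and> j \<in> ?J then (\<sigma> j, q \<sigma> j) else e)" for j \<sigma>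
    have f: "f j \<sigma> \<in> S \<times> R" for j \<sigma>
      using q[of \<sigma> j] e PiE_mem[of \<sigma> ?J "\<lambda>_. S" j] by (auto simp: f_def)
    have "b ^ card ?J \<le> real (card \<B>)" if box: "box_cover f ?J ?Y \<B>" for \<B>
    proof -
      let ?E = "\<lambda>D. ?J \<rightarrow>\<^sub>E {s \<in> S. \<exists>p\<in>R. (s, p) \<in> D}"
      have fB: "finite \<B>" using box by (simp add: box_cover_def)
      have small: "card {s\<in>S. \<exists>p\<in>R. (s, p) \<in> D} \<le> ?k - 1" if D: "D \<in> avoiding" for D
      proof -
        have "{s\<in>S. \<exists>p\<in>R. (s, p) \<in> D} \<noteq> S"
        proof
          assume eq: "{s\<in>S. \<exists>p\<in>R. (s, p) \<in> D} = S"
          have "\<forall>s\<in>S. \<exists>p. p \<in> R \<and> (s, p) \<in> D"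
          proof
            fix s assume "s \<in> S"
            then have "s \<in> {s\<in>S. \<exists>p\<in>R. (s, p) \<in> D}" by (simp only: eq)
            then show "\<exists>p. p \<in> R \<and> (s, p) \<in> D" by blast
          qed
          then obtain p where p: "\<forall>s\<in>S. p s \<in> R \<and> (s, p s) \<in> D" by (rule bchoice[THEN exE])
          have "graph (restrict p S) \<subseteq> D" using p by (auto simp: graph_def)
          moreover have "graph (restrict p S) \<in> graph ` (S \<rightarrow>\<^sub>E R)" using p by (intro imageI) auto
          ultimately show False using D unfolding avoiding_def by blast
        qed
        then have "card {s\<in>S. \<exists>p\<in>R. (s, p) \<in> D} < ?k" using S(1) by (intro psubset_card_mono) auto
        then show ?thesis by simp
      qed
      have "?Y \<subseteq> (\<Union>D\<in>\<B>. PiE ?J (\<lambda>j. {s \<in> S. \<exists>p\<in>R. (s, p) \<in> D j}))"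
      proof
        fix \<sigma> assume s: "\<sigma> \<in> ?Y"
        then obtain D where D: "D \<in> \<B>" "\<forall>j\<in>?J. f j \<sigma> \<in> D j" using box_coverD[OF box] by blast
        have "\<sigma> j \<in> {s \<in> S. \<exists>p\<in>R. (s, p) \<in> D j}" if "j \<in> ?J" for j
          using D(2) that q[OF s that] s PiE_mem[OF s that] by (auto simp: f_def)
        then have "\<sigma> \<in> PiE ?J (\<lambda>j. {s \<in> S. \<exists>p\<in>R. (s, p) \<in> D j})"
          using s by (simp add: PiE_iff)
        then show "\<sigma> \<in> (\<Union>D\<in>\<B>. PiE ?J (\<lambda>j. {s \<in> S. \<exists>p\<in>R. (s, p) \<in> D j}))" using D(1) by blast
      qed
      then have "card ?Y \<le> card (\<Union>D\<in>\<B>. PiE ?J (\<lambda>j. {s \<in> S. \<exists>p\<in>R. (s, p) \<in> D j}))"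
        using fB J S(1) by (intro card_mono) (auto intro!: finite_PiE)
      also have "\<dots> \<le> (\<Sum>D\<in>\<B>. card (PiE ?J (\<lambda>j. {s \<in> S. \<exists>p\<in>R. (s, p) \<in> D j})))"
        by (rule card_UN_le[OF fB])
      also have "\<dots> \<le> (\<Sum>D\<in>\<B>. (?k - 1) ^ card ?J)"
      proof (rule sum_mono)
        fix D assume D: "D \<in> \<B>"
        have "card (PiE ?J (\<lambda>j. {s \<in> S. \<exists>p\<in>R. (s, p) \<in> D j})) = (\<Prod>j\<in>?J. card {s \<in> S. \<exists>p\<in>R. (s, p) \<in> D j})"
          by (rule card_PiE[OF J])
        also have "\<dots> \<le> (\<Prod>j\<in>?J. ?k - 1)"
          using box D small by (intro prod_mono) (auto simp: box_cover_def simp del: One_nat_def)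
        finally show "card (PiE ?J (\<lambda>j. {s \<in> S. \<exists>p\<in>R. (s, p) \<in> D j})) \<le> (?k - 1) ^ card ?J" by simp
      qed
      finally have "?k ^ card ?J \<le> card \<B> * (?k - 1) ^ card ?J" using J by (simp add: card_PiE)
      then have "real (?k ^ card ?J) \<le> real (card \<B> * (?k - 1) ^ card ?J)" by (simp only: of_nat_le_iff)
      then have "real ?k ^ card ?J \<le> real (card \<B>) * (real ?k - 1) ^ card ?J"
        using S(2) by (simp add: of_nat_diff)
      then show ?thesis using S(2) by (simp add: b_def power_divide divide_le_eq)
    qed
    from shat[of ?J f ?Y, OF J W(6)[OF N] f this]
    obtain P V where PV: "P \<in> graph ` (S \<rightarrow>\<^sub>E R)" "V \<subseteq> ?J" "c0 * real (card ?J) \<le> real (card V)"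
      "\<forall>\<tau>. (\<forall>j\<in>V. \<tau> j \<in> P) \<longrightarrow> (\<exists>y\<in>?Y. \<forall>j\<in>V. f j y = \<tau> j)" by blast
    then obtain p where p: "p \<in> S \<rightarrow>\<^sub>E R" "P = graph p" by blast
    have "independence_set X T S (\<lambda>s. B s (p s)) V"
      unfolding independence_set_def
    proof (intro allI impI)
      fix \<sigma> assume s: "\<forall>j\<in>V. \<sigma> j \<in> S"
      then have "\<forall>j\<in>V. (\<sigma> j, p (\<sigma> j)) \<in> P" by (auto simp: p graph_def)
      then obtain y where y: "y \<in> ?Y" "\<forall>j\<in>V. f j y = (\<sigma> j, p (\<sigma> j))"
        using PV(4)[rule_format, of "\<lambda>j. (\<sigma> j, p (\<sigma> j))"] by blast
      have "(T ^^ j) (x y) \<in> B (\<sigma> j) (p (\<sigma> j))" if "j \<in> V" for j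
        using y that PV(2) q[OF y(1), of j] by (auto simp: f_def split: if_splits)
      then show "\<exists>x\<in>topspace X. \<forall>j\<in>V. (T ^^ j) x \<in> B (\<sigma> j) (p (\<sigma> j))" using x y(1) by blast
    qed
    moreover have "c0 * c * real N \<le> real (card V)"
      unfolding mult.assoc
      using mult_left_mono[OF W(5)[OF N] less_imp_le[OF c0]] PV(3) by (rule order_trans)
    moreover have "V \<subseteq> {..<N}" using PV(2) W(4)[OF N] by blast
    ultimately show "\<exists>p\<in>S \<rightarrow>\<^sub>E R. \<exists>V\<subseteq>{..<N}. c0 * c * real N \<le> real (card V) \<and>
        independence_set X T S (\<lambda>s. B s (p s)) V"
      using p(1) by blast
  qed
  then show ?thesis by (meson PiE_mem)
qed


text \<open>
  Only neighbouring sequences are compared in the hypothesis; chaining finitely many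
  comparisons orders all of them.
\<close>

lemma eventually_increasing_sequences:
  assumes "condition_ss l a"
  shows "\<exists>n0. \<forall>n>n0. \<forall>i\<in>{1..l}. \<forall>j\<in>{1..l}. i < j \<longrightarrow> a i n < a j n"
proof -
  have "eventually (\<lambda>n. \<forall>i\<in>{1..<l}. a i n < a (i + 1) n) sequentially"
  proof (rule eventually_ball_finite)
    show "\<forall>i\<in>{1..<l}. eventually (\<lambda>n. a i n < a (i + 1) n) sequentially"
    proof
      fix i assume "i \<in> {1..<l}"
      then have "filterlim (\<lambda>n. real (a (i + 1) n) - real (a i n)) at_top sequentially"
        using assms unfolding condition_ss_def by blast
      then have "eventually (\<lambda>n. 0 < real (a (i + 1) n) - real (a i n)) sequentially"
        unfolding filterlim_at_top_dense by (rule spec)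
      then show "eventually (\<lambda>n. a i n < a (i + 1) n) sequentially"
        by (rule eventually_mono) simp
    qed
  qed simp
  then obtain n0 where n0: "\<And>n i. n0 \<le> n \<Longrightarrow> i \<in> {1..<l} \<Longrightarrow> a i n < a (i + 1) n"
    unfolding eventually_sequentially by blast
  have "a i n < a j n" if "n0 < n" "1 \<le> i" "j \<le> l" "i < j" for n i j
    using that(4,3)
  proof (induction j)
    case (Suc j)
    have "a j n < a (Suc j) n" if "1 \<le> j" using n0[of n j] that Suc.prems \<open>n0 < n\<close> by simp
    then show ?case using Suc \<open>1 \<le> i\<close> by (cases "i = j") fastforce+
  qed simp
  then show ?thesis by (intro exI[of _ n0]) auto
qed

lemma residue_class_thinning:
  assumes "finite F" "0 < M"
  shows "\<exists>W\<subseteq>F. real (card F) / real M \<le> real (card W) \<and> (\<forall>j\<in>W. \<forall>k\<in>W. j mod M = k mod M)"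
proof (rule ccontr)
  assume none: "\<not> ?thesis"
  have small: "real (card {j\<in>F. j mod M = r}) < real (card F) / real M" for r
  proof (rule ccontr)
    assume "\<not> ?thesis"
    then show False using none by (metis (mono_tags, lifting) linorder_not_less mem_Collect_eq subsetI)
  qed
  have "card F \<le> card (\<Union>r<M. {j\<in>F. j mod M = r})"
    using assms by (intro card_mono) auto
  also have "\<dots> \<le> (\<Sum>r<M. card {j\<in>F. j mod M = r})" by (rule card_UN_le) simp
  finally have "real (card F) \<le> (\<Sum>r<M. real (card {j\<in>F. j mod M = r}))"
    by (simp only: of_nat_sum[symmetric] of_nat_le_iff)
  also have "\<dots> < (\<Sum>r<M. real (card F) / real M)"
    using small assms(2) by (intro sum_strict_mono) auto
  finally show False using assms(2) by simp
qed

text \<open>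
  Let \<open>W\<close> be an independence set for \<open>\<C>\<close> and let \<open>V\<close> consist of times \<open>j\<close> with \<open>j\<close> and all
  \<open>j + a i n\<close> in \<open>W\<close>. An itinerary on \<open>V\<close> through the new sets prescribes members of \<open>\<C>\<close>
  at the times \<open>j\<close> and \<open>j + a i n\<close>. These prescriptions are compatible with each other as
  soon as the times are pairwise distinct, and then a point realising them exists by
  independence of \<open>W\<close>.
\<close>

lemma densely_independent_extend:
  assumes pos: "positive_sequences l a" and cond: "condition_ss l a"
    and good: "good_for_liminf_recurrence l a"
    and T: "T \<in> topspace X \<rightarrow> topspace X"
    and ne: "\<C> \<noteq> {}"
    and dense: "densely_independent X T \<C> (\<lambda>C. C)"
  shows "\<exists>n\<ge>1. densely_independent X T (\<C> \<times> ({1..l} \<rightarrow>\<^sub>E \<C>))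
           (\<lambda>(C, f). {x\<in>C. \<forall>i\<in>{1..l}. (T ^^ a i n) x \<in> f i})"
proof -
  have l: "1 \<le> l" using pos by (simp add: positive_sequences_def)
  obtain n0 where n0: "\<forall>n>n0. \<forall>i\<in>{1..l}. \<forall>j\<in>{1..l}. i < j \<longrightarrow> a i n < a j n"
    using eventually_increasing_sequences[OF cond] by blast
  obtain c I W where W: "0 < c" "infinite I"
    "\<forall>N\<in>I. 0 < N \<and> W N \<subseteq> {..<N} \<and> c * real N \<le> real (card (W N)) \<and>
      W N \<noteq> {} \<and> independence_set X T \<C> (\<lambda>C. C) (W N)"
    using dense by (rule densely_independentE)
  obtain n c' where n: "n0 < n" "0 < c'"
    "infinite {N\<in>I. c' * real N \<le> real (card {j\<in>W N. \<forall>i\<in>{1..l}. j + a i n \<in> W N})}"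
    using recurrence_of_dense_sets[OF l good W(2,1), of W n0] W(3) by blast
  \<comment> \<open>the offset \<open>0\<close> treats the time \<open>j\<close> itself on a par with the times \<open>j + a i n\<close>\<close>
  define e where "e i = (if i = 0 then 0 else a i n)" for i
  have e_less: "e i < e j" if "i < j" "j \<le> l" for i j
  proof (cases "i = 0")
    case True
    then show ?thesis using pos that n(1) by (auto simp: e_def positive_sequences_def Suc_le_eq)
  next
    case False
    then show ?thesis using n0 n(1) that by (auto simp: e_def)
  qed
  have e_le: "e i \<le> e l" if "i \<le> l" for i
    using e_less[of i l] that by (cases "i = l") auto
  \<comment> \<open>within one residue class modulo a number above all offsets, the times \<open>j + e i\<close> are
    distinct\<close>
  define M where "M = Suc (e l)"
  have M: "0 < M" by (simp add: M_def)
  let ?A = "\<lambda>(C, f). {x\<in>C. \<forall>i\<in>{1..l}. (T ^^ a i n) x \<in> f i}"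
  let ?S = "\<C> \<times> ({1..l} \<rightarrow>\<^sub>E \<C>)"
  have "densely_independent X T ?S ?A"
  proof (rule densely_independentI[OF _ n(3)])
    show "0 < c' / real M" using n(2) M by simp
    fix N assume "N \<in> {N\<in>I. c' * real N \<le> real (card {j\<in>W N. \<forall>i\<in>{1..l}. j + a i n \<in> W N})}"
    then have N: "N \<in> I" "c' * real N \<le> real (card {j\<in>W N. \<forall>i\<in>{1..l}. j + a i n \<in> W N})" by auto
    let ?F = "{j\<in>W N. \<forall>i\<in>{1..l}. j + a i n \<in> W N}"
    have WN: "W N \<subseteq> {..<N}" "independence_set X T \<C> (\<lambda>C. C) (W N)" using W(3) N(1) by auto
    have "?F \<subseteq> {..<N}" using WN(1) by blast
    then have "finite ?F" by (rule finite_subset) simp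
    then obtain V where V: "V \<subseteq> ?F" "real (card ?F) / real M \<le> real (card V)"
      "\<forall>j\<in>V. \<forall>k\<in>V. j mod M = k mod M"
      using residue_class_thinning[of ?F M, OF _ M] by blast
    have VW: "j + e i \<in> W N" if "j \<in> V" "i \<in> {0..l}" for j i
      using that V(1) by (auto simp: e_def)
    let ?g = "\<lambda>(j, i). j + e i"
    have inj: "inj_on ?g (V \<times> {0..l})"
    proof (rule inj_onI, clarify)
      fix j i j' i' assume *: "j \<in> V" "i \<in> {0..l}" "j' \<in> V" "i' \<in> {0..l}" "j + e i = j' + e i'"
      have "j mod M = j' mod M" using V(3) *(1,3) by blast
      then have "int j mod int M = int j' mod int M" by (simp flip: of_nat_mod)
      then have "int M dvd int j - int j'" by (simp add: mod_eq_dvd_iff)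
      also have "int j - int j' = int (e i') - int (e i)" using *(5) by linarith
      finally have "int M dvd int (e i') - int (e i)" .
      moreover have "\<bar>int (e i') - int (e i)\<bar> < int M"
        using e_le[of i] e_le[of i'] *(2,4) by (auto simp: M_def)
      ultimately have "int (e i') - int (e i) = 0"
        using dvd_imp_le_int[of "int (e i') - int (e i)" "int M"] by linarith
      then have ee: "e i = e i'" by simp
      have "i = i'"
      proof (cases i i' rule: linorder_cases)
        case less
        then show ?thesis using e_less[of i i'] ee *(4) by simp
      next
        case greater
        then show ?thesis using e_less[of i' i] ee *(2) by simp
      qed
      then show "j = j' \<and> i = i'" using *(5) by simp
    qed
    have "independence_set X T ?S ?A V"
      unfolding independence_set_def
    proof (intro allI impI)
      fix \<sigma> assume s: "\<forall>j\<in>V. \<sigma> j \<in> ?S"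
      obtain C0 where C0: "C0 \<in> \<C>" using ne by blast
      define h where "h = (\<lambda>(j, i). if i = 0 then fst (\<sigma> j) else snd (\<sigma> j) i)"
      define \<tau> where "\<tau> k = (if k \<in> ?g ` (V \<times> {0..l}) then h (the_inv_into (V \<times> {0..l}) ?g k) else C0)" for k
      have hC: "h (j, i) \<in> \<C>" if "j \<in> V" "i \<in> {0..l}" for j i
      proof -
        have "\<sigma> j \<in> ?S" using s that by blast
        then obtain C f where Cf: "\<sigma> j = (C, f)" "C \<in> \<C>" "f \<in> {1..l} \<rightarrow>\<^sub>E \<C>" by blast
        then show ?thesis using that PiE_mem[OF Cf(3), of i] by (auto simp: h_def)
      qed
      have tau: "\<tau> (j + e i) = h (j, i)" if "j \<in> V" "i \<in> {0..l}" for j i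
      proof -
        have "the_inv_into (V \<times> {0..l}) ?g (?g (j, i)) = (j, i)"
          using that by (intro the_inv_into_f_f[OF inj]) simp
        moreover have "j + e i \<in> ?g ` (V \<times> {0..l})" using that by force
        ultimately show ?thesis by (simp add: \<tau>_def)
      qed
      have "\<tau> k \<in> \<C>" for k
      proof (cases "k \<in> ?g ` (V \<times> {0..l})")
        case True
        then obtain j i where "j \<in> V" "i \<in> {0..l}" "k = j + e i" by auto
        then show ?thesis using tau hC by simp
      qed (simp add: \<tau>_def C0)
      then obtain x where x: "x \<in> topspace X" "\<forall>k\<in>W N. (T ^^ k) x \<in> \<tau> k"
        using WN(2) unfolding independence_set_def by blast
      have "(T ^^ j) x \<in> ?A (\<sigma> j)" if j: "j \<in> V" for j
      proof -
        obtain C f where Cf: "\<sigma> j = (C, f)" using prod.exhaust by blast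
        have *: "(T ^^ (e i + j)) x \<in> h (j, i)" if "i \<in> {0..l}" for i
          using x(2) VW[OF j that] tau[OF j that] by (metis add.commute)
        have "(T ^^ j) x \<in> C" using *[of 0] by (simp add: Cf h_def e_def)
        moreover have "(T ^^ a i n) ((T ^^ j) x) \<in> f i" if "i \<in> {1..l}" for i
          using *[of i] that by (simp add: Cf h_def e_def funpow_add)
        ultimately show ?thesis by (simp add: Cf)
      qed
      then show "\<exists>x\<in>topspace X. \<forall>j\<in>V. (T ^^ j) x \<in> ?A (\<sigma> j)"
        using x(1) by (intro bexI[of _ x] ballI)
    qed
    moreover have "c' / real M * real N \<le> real (card V)"
      using divide_right_mono[OF N(2), of "real M"] V(2) by simp
    moreover have "V \<subseteq> {..<N}" using V(1) WN(1) by blast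
    ultimately show "\<exists>V\<subseteq>{..<N}. c' / real M * real N \<le> real (card V) \<and> independence_set X T ?S ?A V"
      by blast
  qed
  then show ?thesis using n(1) by (intro exI[of _ n]) simp
qed

section \<open>Independence from positive entropy\<close>

lemma (in Metric_space) Lebesgue_number:
  assumes comp: "compact_space mtopology" and cov: "\<And>U. U \<in> \<U> \<Longrightarrow> openin mtopology U" "\<Union>\<U> = M"
  shows "\<exists>\<delta>>0. \<forall>x\<in>M. \<exists>U\<in>\<U>. mball x \<delta> \<subseteq> U"
proof -
  have "\<forall>x\<in>M. \<exists>r. 0 < r \<and> (\<exists>U\<in>\<U>. mball x (2 * r) \<subseteq> U)"
  proof
    fix x assume "x \<in> M"
    then obtain U where U: "U \<in> \<U>" "x \<in> U" using cov(2) by blast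
    then obtain r where "0 < r" "mball x r \<subseteq> U" using cov(1) openin_mtopology by blast
    then show "\<exists>r. 0 < r \<and> (\<exists>U\<in>\<U>. mball x (2 * r) \<subseteq> U)"
      using U(1) by (intro exI[of _ "r / 2"]) auto
  qed
  then obtain r where r: "\<forall>x\<in>M. 0 < r x \<and> (\<exists>U\<in>\<U>. mball x (2 * r x) \<subseteq> U)"
    by (rule bchoice[THEN exE])
  have "\<exists>\<F>. finite \<F> \<and> \<F> \<subseteq> (\<lambda>x. mball x (r x)) ` M \<and> \<Union>\<F> = topspace mtopology"
  proof (rule comp[unfolded compact_space, rule_format], intro conjI ballI)
    show "\<Union>((\<lambda>x. mball x (r x)) ` M) = topspace mtopology" using r by fastforce
  qed auto
  then obtain \<F> where \<F>: "finite \<F>" "\<F> \<subseteq> (\<lambda>x. mball x (r x)) ` M" "\<Union>\<F> = M" by auto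
  obtain F where F: "F \<subseteq> M" "finite F" "\<F> = (\<lambda>x. mball x (r x)) ` F"
    using finite_subset_image[OF \<F>(1,2)] by blast
  define \<delta> where "\<delta> = Min (insert 1 (r ` F))"
  have d: "0 < \<delta>" "\<And>x. x \<in> F \<Longrightarrow> \<delta> \<le> r x"
    unfolding \<delta>_def using F r by (auto simp: Min_gr_iff)
  have "\<exists>U\<in>\<U>. mball x \<delta> \<subseteq> U" if "x \<in> M" for x
  proof -
    obtain z where z: "z \<in> F" "x \<in> mball z (r z)" using F(3) \<F>(3) \<open>x \<in> M\<close> by blast
    obtain U where U: "U \<in> \<U>" "mball z (2 * r z) \<subseteq> U" using r z(1) F(1) by blast
    have "mball x \<delta> \<subseteq> mball z (2 * r z)"
      using z d(2)[OF z(1)] commute[of x z] by (intro mball_subset) auto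
    then show ?thesis using U by blast
  qed
  then show ?thesis using d(1) by blast
qed

lemma (in Metric_space) finite_small_closed_cover:
  assumes comp: "compact_space mtopology" and "0 < \<epsilon>"
  obtains \<K> where "finite \<K>" "\<forall>K\<in>\<K>. closedin mtopology K \<and> (\<forall>x\<in>K. \<forall>y\<in>K. d x y < \<epsilon>)" "\<Union>\<K> = M"
proof -
  have "mtotally_bounded M"
    using comp by (intro compactin_imp_mtotally_bounded) (simp add: compact_space_def)
  then obtain F where F: "finite F" "F \<subseteq> M" "M \<subseteq> (\<Union>x\<in>F. mball x (\<epsilon> / 3))"
    unfolding mtotally_bounded_def using assms(2) by (metis divide_pos_pos zero_less_numeral)
  let ?K = "(\<lambda>x. mcball x (\<epsilon> / 3)) ` F"
  have "d x y < \<epsilon>" if "x \<in> mcball z (\<epsilon> / 3)" "y \<in> mcball z (\<epsilon> / 3)" for x y z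
  proof -
    have "d x y \<le> d z x + d z y" using that triangle''[of x z y] by auto
    then show ?thesis using that assms(2) by auto
  qed
  moreover have "\<Union>?K = M" using F(3) mcball_subset_mspace by fastforce
  ultimately show ?thesis using F(1) by (intro that[of ?K]) auto
qed

lemma compact_metrizable_imp_second_countable:
  assumes "compact_space X" "metrizable_space X"
  shows "second_countable X"
proof -
  obtain M d where "Metric_space M d" and X: "X = Metric_space.mtopology M d"
    using assms(2) unfolding metrizable_space_def by blast
  interpret Metric_space M d by fact
  have "mtotally_bounded M"
    using assms(1) X by (intro compactin_imp_mtotally_bounded) (simp add: compact_space_def)
  then have "\<forall>k::nat. \<exists>F. finite F \<and> F \<subseteq> M \<and> M \<subseteq> (\<Union>x\<in>F. mball x (1 / Suc k))"
    unfolding mtotally_bounded_def by (metis divide_pos_pos of_nat_0_less_iff zero_less_Suc zero_less_one)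
  then obtain F where F: "\<And>k. finite (F k)" "\<And>k. F k \<subseteq> M" "\<And>k. M \<subseteq> (\<Union>x\<in>F k. mball x (1 / Suc k))"
    by metis
  let ?B = "\<Union>k. (\<lambda>x. mball x (1 / Suc k)) ` F k"
  have "\<exists>V\<in>?B. x \<in> V \<and> V \<subseteq> U" if U: "openin X U" "x \<in> U" for U x
  proof -
    obtain r where r: "0 < r" "mball x r \<subseteq> U" using U X openin_mtopology by blast
    have xM: "x \<in> M" using U openin_subset X by fastforce
    obtain k where k: "1 / Suc k < r / 2" using r(1) nat_approx_posE half_gt_zero by blast
    obtain z where z: "z \<in> F k" "x \<in> mball z (1 / Suc k)" using F(3)[of k] xM by blast
    have "mball z (1 / Suc k) \<subseteq> mball x r"
      using z k xM by (intro mball_subset) (auto simp: commute)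
    then show ?thesis using z r(2) by blast
  qed
  then show ?thesis
    unfolding second_countable_def
  proof (intro exI[of _ ?B] conjI allI impI ballI)
    show "countable ?B" using F(1) by (intro countable_UN[OF countableI_type] countable_finite finite_imageI)
    show "openin X V" if "V \<in> ?B" for V using that X by auto
  qed blast
qed

lemma min_subcover_card_le:
  assumes "\<V> \<subseteq> \<U>" "finite \<V>" "\<Union>\<V> = topspace X"
  shows "min_subcover_card X \<U> \<le> card \<V>"
  unfolding min_subcover_card_def by (rule Least_le) (use assms in blast)

text \<open>
  Name the points by the members of a finite cover \<open>\<K>\<close> by small closed sets, with the
  pairs of disjoint members as patterns. If \<open>D \<subseteq> \<K>\<close> contains no pattern, its members meet
  pairwise, so their union has small diameter and lies in a member of the open cover \<open>\<U>\<close>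
  by Lebesgue's lemma. Hence a cover by boxes induces an equally large subcover of the
  iterated join of \<open>\<U>\<close>; its cardinality grows exponentially because \<open>\<U>\<close> has positive
  entropy, and shattering applies.
\<close>

theorem positive_entropy_imp_independent_pair:
  assumes sys: "topological_dynamical_system X T" and ent: "0 < topological_entropy X T"
  obtains A B where "closedin X A" "closedin X B" "A \<inter> B = {}" "densely_independent X T {A, B} (\<lambda>C. C)"
proof -
  have comp: "compact_space X" and T: "T \<in> topspace X \<rightarrow> topspace X"
    using sys by (auto simp: topological_dynamical_system_def homeomorphic_map_def
        dest: continuous_map_funspace quotient_imp_continuous_map homeomorphic_imp_continuous_map)
  obtain M d where "Metric_space M d" and X: "X = Metric_space.mtopology M d"
    using sys unfolding topological_dynamical_system_def metrizable_space_def by blast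
  interpret Metric_space M d by fact
  have XM: "topspace X = M" using X by simp
  obtain \<U> where U: "open_cover X \<U>" "0 < cover_entropy X T \<U>"
    using ent unfolding topological_entropy_def less_SUP_iff by blast
  obtain h where h: "0 < ereal h" "ereal h < cover_entropy X T \<U>"
    using ereal_dense2[OF U(2)] by auto
  let ?N = "\<lambda>n. min_subcover_card X (iterated_join X T \<U> n)"
  define I where "I = {n. 0 < n \<and> h < 1 / real n * ln (real (?N n))}"
  have I: "infinite I"
  proof
    assume "finite I"
    then have "eventually (\<lambda>n. n \<notin> I) sequentially"
      unfolding cofinite_eq_sequentially[symmetric] eventually_cofinite by simp
    then have "eventually (\<lambda>n. ereal (1 / real n * ln (real (?N n))) \<le> ereal h) sequentially"
      using eventually_gt_at_top[of 0] by eventually_elim (simp add: I_def)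
    then have "cover_entropy X T \<U> \<le> ereal h" unfolding cover_entropy_def by (rule Limsup_bounded)
    then show False using h(2) by simp
  qed
  define b where "b = exp h"
  have b: "1 < b" using h(1) by (simp add: b_def)
  have Nb: "b ^ n \<le> real (?N n)" if "n \<in> I" for n
  proof -
    have n: "0 < n" "h * n < ln (real (?N n))" using that by (auto simp: I_def field_simps)
    then have "0 < ln (real (?N n))" using h(1) by (smt (verit) ereal_less(2) mult_nonneg_nonneg of_nat_0_le_iff)
    then have "0 < real (?N n)" by (metis ln_0 less_irrefl of_nat_0 of_nat_0_less_iff gr0I)
    then have "exp (h * n) \<le> real (?N n)" using n(2) by (metis exp_le_cancel_iff exp_ln less_imp_le)
    then show ?thesis by (simp add: b_def mult.commute flip: exp_of_nat_mult)
  qed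
  have "\<exists>\<delta>>0. \<forall>x\<in>M. \<exists>U\<in>\<U>. mball x \<delta> \<subseteq> U"
  proof (rule Lebesgue_number)
    show "compact_space mtopology" using comp X by simp
    show "\<Union>\<U> = M" "\<And>U. U \<in> \<U> \<Longrightarrow> openin mtopology U"
      using U(1) X XM by (auto simp: open_cover_def)
  qed
  then obtain \<delta> where \<delta>: "0 < \<delta>" "\<forall>x\<in>M. \<exists>U\<in>\<U>. mball x \<delta> \<subseteq> U" by blast
  \<comment> \<open>two members that meet have all their points within \<open>\<delta> / 2 + \<delta> / 2\<close> of each other\<close>
  have \<delta>2: "0 < \<delta> / 2" using \<delta>(1) by simp
  obtain \<K> where K: "finite \<K>" "\<forall>K\<in>\<K>. closedin mtopology K \<and> (\<forall>x\<in>K. \<forall>y\<in>K. d x y < \<delta> / 2)" "\<Union>\<K> = M"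
    by (rule finite_small_closed_cover[OF comp[unfolded X] \<delta>2])
  have XU: "M \<noteq> {}"
  proof
    assume e: "M = {}"
    obtain n where n: "n \<in> I" using infinite_imp_nonempty[OF I] by blast
    have "?N n \<le> card ({} :: 'a set set)" by (rule min_subcover_card_le) (auto simp: XM e)
    then have "real (?N n) = 0" by simp
    moreover have "0 < b ^ n" using b by simp
    ultimately show False using Nb[OF n] by linarith
  qed
  define patterns where "patterns = {{P, Q} |P Q. P \<in> \<K> \<and> Q \<in> \<K> \<and> P \<noteq> Q \<and> P \<inter> Q = {}}"
  interpret pattern_system \<K> patterns
  proof
    show "P \<subseteq> \<K>" if "P \<in> patterns" for P using that unfolding patterns_def by blast
    show "2 \<le> card P" if P: "P \<in> patterns" for P
    proof -
      obtain A B where "P = {A, B}" "A \<noteq> B" using P unfolding patterns_def by blast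
      then show ?thesis by simp
    qed
  qed (rule K(1))
  obtain K0 where K0: "K0 \<in> \<K>" using K(3) XU by blast
  have small_union: "\<exists>U\<in>\<U>. \<Union>D \<subseteq> U" if D: "D \<in> avoiding" for D
  proof (cases "\<exists>P\<in>D. P \<noteq> {}")
    case True
    then obtain P x where P: "P \<in> D" "x \<in> P" by blast
    have DK: "D \<subseteq> \<K>" using D by (simp add: avoiding_def)
    have PM: "Q \<subseteq> M" if "Q \<in> D" for Q using that DK K(3) by blast
    have "y \<in> mball x \<delta>" if y: "Q \<in> D" "y \<in> Q" for y Q
    proof -
      have "P \<inter> Q \<noteq> {}"
      proof
        assume "P \<inter> Q = {}"
        moreover from this have "P \<noteq> Q" using P(2) by blast
        ultimately have "{P, Q} \<in> patterns" using DK P(1) y(1) unfolding patterns_def by blast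
        then have "\<not> {P, Q} \<subseteq> D" using D by (simp add: avoiding_def del: insert_subset)
        then show False using P(1) y(1) by simp
      qed
      then obtain z where z: "z \<in> P" "z \<in> Q" by blast
      have M: "x \<in> M" "y \<in> M" "z \<in> M" using PM P y z by blast+
      have "d x z < \<delta> / 2" "d z y < \<delta> / 2" using K(2) DK P y z by blast+
      then have "d x y < \<delta>" using triangle[OF M(1,3,2)] by linarith
      then show ?thesis using M by simp
    qed
    then have "\<Union>D \<subseteq> mball x \<delta>" by blast
    moreover have "x \<in> M" using PM P by blast
    then obtain U where "U \<in> \<U>" "mball x \<delta> \<subseteq> U" using \<delta>(2) by blast
    ultimately show ?thesis by (intro bexI[of _ U] order_trans[of "\<Union>D" "mball x \<delta>" U])
  next
    case False
    then have "\<Union>D = {}" by auto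
    moreover obtain x U where "x \<in> M" "U \<in> \<U>" using XU \<delta>(2) by blast
    ultimately show ?thesis by (intro bexI[of _ U]) (simp_all only: empty_subsetI)
  qed
  define f where "f j y = (if \<exists>K\<in>\<K>. (T ^^ j) y \<in> K then SOME K. K \<in> \<K> \<and> (T ^^ j) y \<in> K else K0)" for j y
  have f: "f j y \<in> \<K>" for j y
  proof (cases "\<exists>K\<in>\<K>. (T ^^ j) y \<in> K")
    case True
    then have "\<exists>K. K \<in> \<K> \<and> (T ^^ j) y \<in> K" by blast
    from someI_ex[OF this] show ?thesis using True by (simp add: f_def)
  qed (simp add: f_def K0)
  have fy: "(T ^^ j) y \<in> f j y" if "y \<in> M" for j y
  proof -
    have "\<exists>K. K \<in> \<K> \<and> (T ^^ j) y \<in> K" using funpow_in_topspace[OF T, of y j] that XM K(3) by blast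
    from someI_ex[OF this] this show ?thesis by (auto simp: f_def)
  qed
  have box: "real (?N n) \<le> real (card \<B>)" if \<B>: "box_cover f {..<n} M \<B>" for n \<B>
  proof -
    have "\<forall>D\<in>\<B>. \<exists>V. \<forall>j<n. V j \<in> \<U> \<and> \<Union>(D j) \<subseteq> V j"
    proof
      fix D assume D: "D \<in> \<B>"
      have "\<forall>j\<in>{..<n}. \<exists>V. V \<in> \<U> \<and> \<Union>(D j) \<subseteq> V"
      proof
        fix j assume "j \<in> {..<n}"
        then have "D j \<in> avoiding" using \<B> D by (simp add: box_cover_def)
        from small_union[OF this] show "\<exists>V. V \<in> \<U> \<and> \<Union>(D j) \<subseteq> V" unfolding Bex_def .
      qed
      then obtain V where "\<forall>j\<in>{..<n}. V j \<in> \<U> \<and> \<Union>(D j) \<subseteq> V j" by (rule bchoice[THEN exE])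
      then show "\<exists>V. \<forall>j<n. V j \<in> \<U> \<and> \<Union>(D j) \<subseteq> V j" by (intro exI[of _ V]) simp
    qed
    then obtain V where V: "\<forall>D\<in>\<B>. \<forall>j<n. V D j \<in> \<U> \<and> \<Union>(D j) \<subseteq> V D j"
      by (rule bchoice[THEN exE])
    let ?V = "\<lambda>D. topspace X \<inter> (\<Inter>k\<in>{..<n}. (T ^^ k) -` V D k)"
    have fB: "finite \<B>" using \<B> by (simp add: box_cover_def)
    have "?N n \<le> card (?V ` \<B>)"
    proof (rule min_subcover_card_le)
      show "?V ` \<B> \<subseteq> iterated_join X T \<U> n"
      proof (rule image_subsetI)
        fix D assume "D \<in> \<B>"
        then have "\<forall>k<n. V D k \<in> \<U>" using V by simp
        then show "?V D \<in> iterated_join X T \<U> n"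
          unfolding iterated_join_def by (intro CollectI exI[of _ "V D"] conjI refl)
      qed
      show "finite (?V ` \<B>)" using fB by simp
      show "\<Union>(?V ` \<B>) = topspace X"
      proof
        show "topspace X \<subseteq> \<Union>(?V ` \<B>)"
        proof
          fix y assume y: "y \<in> topspace X"
          then obtain D where D: "D \<in> \<B>" "\<forall>j\<in>{..<n}. f j y \<in> D j"
            using box_coverD[OF \<B>, of y] XM by auto
          have "(T ^^ k) y \<in> V D k" if "k < n" for k
          proof -
            have "(T ^^ k) y \<in> \<Union>(D k)" using fy[of y k] y XM D(2) that by (intro UnionI) auto
            moreover have "\<Union>(D k) \<subseteq> V D k" using V D(1) that by simp
            ultimately show ?thesis by (rule subsetD[rotated])
          qed
          then show "y \<in> \<Union>(?V ` \<B>)" using D(1) y by (intro UnionI[OF imageI[OF D(1)]]) simp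
        qed
      qed blast
    qed
    also have "\<dots> \<le> card \<B>" using fB by (rule card_image_le)
    finally show ?thesis by simp
  qed
  obtain c where c: "0 < c"
    and shat: "\<And>(f :: nat \<Rightarrow> 'a \<Rightarrow> 'a set) J Y. \<lbrakk>finite J; J \<noteq> {}; \<And>j y. f j y \<in> \<K>;
        \<And>\<B>. box_cover f J Y \<B> \<Longrightarrow> b ^ card J \<le> real (card \<B>)\<rbrakk> \<Longrightarrow>
      \<exists>P\<in>patterns. \<exists>W\<subseteq>J. c * real (card J) \<le> real (card W) \<and>
        (\<forall>\<tau>. (\<forall>j\<in>W. \<tau> j \<in> P) \<longrightarrow> (\<exists>y\<in>Y. \<forall>j\<in>W. f j y = \<tau> j))"
    using exponential_cover_shatters[OF b, where 'p="'a"] by blast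
  have "\<exists>P\<in>patterns. densely_independent X T P (\<lambda>C. C)"
  proof (rule densely_independent_pigeonhole[OF c I finite_patterns])
    fix n assume n: "n \<in> I"
    have ne: "{..<n} \<noteq> {}" using n by (auto simp: I_def)
    have "b ^ card {..<n} \<le> real (card \<B>)" if "box_cover f {..<n} M \<B>" for \<B>
      using Nb[OF n] box[OF that] by simp
    from shat[of "{..<n}" f M, OF finite_lessThan ne f this]
    obtain P W where W: "P \<in> patterns" "W \<subseteq> {..<n}" "c * real n \<le> real (card W)"
      "\<forall>\<tau>. (\<forall>j\<in>W. \<tau> j \<in> P) \<longrightarrow> (\<exists>y\<in>M. \<forall>j\<in>W. f j y = \<tau> j)" by auto
    have "independence_set X T P (\<lambda>C. C) W"
      unfolding independence_set_def
    proof (intro allI impI)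
      fix \<sigma> assume "\<forall>j\<in>W. \<sigma> j \<in> P"
      then obtain y where "y \<in> M" "\<forall>j\<in>W. f j y = \<sigma> j" using W(4) by blast
      then show "\<exists>x\<in>topspace X. \<forall>j\<in>W. (T ^^ j) x \<in> \<sigma> j" using fy XM by metis
    qed
    then show "\<exists>P\<in>patterns. \<exists>W\<subseteq>{..<n}. c * real n \<le> real (card W) \<and> independence_set X T P (\<lambda>C. C) W"
      using W by blast
  qed
  then obtain P where P: "P \<in> patterns" "densely_independent X T P (\<lambda>C. C)" by blast
  then obtain A B where AB: "P = {A, B}" "A \<in> \<K>" "B \<in> \<K>" "A \<inter> B = {}"
    unfolding patterns_def by blast
  show ?thesis using that[of A B] AB P(2) K(2) X by blast
qed

section \<open>An open-set criterion for weak mixing along the sequences\<close>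

lemma continuous_map_funpow: "continuous_map X X T \<Longrightarrow> continuous_map X X (T ^^ n)"
  by (induction n) (auto intro: continuous_map_compose simp: id_def[symmetric])

lemma power_map_funpow:
  assumes "x \<in> extensional {1..m}"
  shows "(power_map m T ^^ n) x = (\<lambda>j\<in>{1..m}. (T ^^ n) (x j))"
proof (induction n)
  case 0
  then show ?case using assms by (simp add: extensional_restrict)
next
  case (Suc n)
  then show ?case by (auto simp: power_map_def)
qed

text \<open>
  For targets taken from a countable base, the points of \<open>E\<^sup>m\<close> whose orbits along the
  sequences hit a given tuple of targets form an open subset \<open>G W\<close> of \<open>E\<^sup>m\<close>; it is dense
  by the assumption. A point in the intersection of these countably many sets comes close
  to every point of \<open>(E\<^sup>m)\<^sup>l\<close>.
\<close>

lemma Delta_weakly_mixing_criterion: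
  assumes sys: "topological_dynamical_system X T" and E: "closedin X E"
    and mix: "\<And>m U V. (\<And>j. j \<in> {1..m} \<Longrightarrow> openin X (U j) \<and> U j \<inter> E \<noteq> {}) \<Longrightarrow>
      (\<And>i j. i \<in> {1..l} \<Longrightarrow> j \<in> {1..m} \<Longrightarrow> openin X (V i j) \<and> V i j \<inter> E \<noteq> {}) \<Longrightarrow>
      \<exists>n\<ge>1. \<forall>j\<in>{1..m::nat}. \<exists>x\<in>U j \<inter> E. \<forall>i\<in>{1..l}. (T ^^ a i n) x \<in> V i j"
  shows "Delta_weakly_mixing l a X T E"
proof -
  have T: "continuous_map X X T"
    using sys by (simp add: topological_dynamical_system_def homeomorphic_imp_continuous_map)
  obtain \<B> where \<B>: "countable \<B>" "\<And>V. V \<in> \<B> \<Longrightarrow> openin X V"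
    "\<And>U x. openin X U \<Longrightarrow> x \<in> U \<Longrightarrow> \<exists>V\<in>\<B>. x \<in> V \<and> V \<subseteq> U"
    using compact_metrizable_imp_second_countable[of X] sys
    unfolding topological_dynamical_system_def second_countable_def by metis
  have EX: "E \<subseteq> topspace X" using E by (rule closedin_subset)
  have "Delta_transitive l a (power_space m X) (power_map m T) (power_set m E)" for m
  proof -
    let ?Y = "power_space m X" and ?E = "power_set m E"
    have YE: "?E \<subseteq> topspace ?Y" using EX by (auto simp: power_space_def power_set_def PiE_iff)
    have clE: "closedin ?Y ?E"
      using E by (simp add: power_space_def power_set_def closedin_product_topology)
    have pw: "(power_map m T ^^ n) x = (\<lambda>j\<in>{1..m}. (T ^^ n) (x j))" if "x \<in> ?E" for n x
      using that by (intro power_map_funpow) (auto simp: power_set_def PiE_iff)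
    define \<Omega> where "\<Omega> = {W \<in> {1..l} \<times> {1..m} \<rightarrow>\<^sub>E \<B>. \<forall>p\<in>{1..l} \<times> {1..m}. W p \<inter> E \<noteq> {}}"
    define G where "G W = {x\<in>?E. \<exists>n\<ge>1. \<forall>i\<in>{1..l}. \<forall>j\<in>{1..m}. (T ^^ a i n) (x j) \<in> W (i, j)}" for W
    have "countable ({1..l} \<times> {1..m} \<rightarrow>\<^sub>E \<B>)" using \<B>(1) by (intro countable_PiE) auto
    then have cO: "countable \<Omega>" by (rule countable_subset[rotated]) (auto simp: \<Omega>_def)
    have WO: "openin X (W (i, j)) \<and> W (i, j) \<inter> E \<noteq> {}" if "W \<in> \<Omega>" "i \<in> {1..l}" "j \<in> {1..m}" for W i j
      using that \<B>(2) PiE_mem[of W "{1..l} \<times> {1..m}" "\<lambda>_. \<B>" "(i, j)"] by (auto simp: \<Omega>_def)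
    have openG: "openin (subtopology ?Y ?E) (G W)" if W: "W \<in> \<Omega>" for W
    proof -
      let ?P = "\<lambda>n j. (\<Inter>i\<in>{1..l}. {x\<in>topspace X. (T ^^ a i n) x \<in> W (i, j)}) \<inter> topspace X"
      have "openin X (?P n j)" if "j \<in> {1..m}" for n j
        using WO[OF W _ that]
        by (intro openin_INT openin_continuous_map_preimage[OF continuous_map_funpow[OF T]]) auto
      then have "openin ?Y (PiE {1..m} (?P n))" for n
        by (simp add: power_space_def openin_PiE_gen)
      then have "openin ?Y (\<Union>n\<in>{1..}. PiE {1..m} (?P n))" by (intro openin_Union) auto
      moreover have "G W = (\<Union>n\<in>{1..}. PiE {1..m} (?P n)) \<inter> ?E"
      proof (intro set_eqI iffI)
        fix x assume "x \<in> G W"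
        then obtain n where n: "1 \<le> n" "\<forall>i\<in>{1..l}. \<forall>j\<in>{1..m}. (T ^^ a i n) (x j) \<in> W (i, j)" and x: "x \<in> ?E"
          by (auto simp: G_def)
        have "x \<in> PiE {1..m} (?P n)"
        proof (rule PiE_I)
          fix j assume j: "j \<in> {1..m}"
          then have "x j \<in> topspace X" using x EX by (auto simp: power_set_def PiE_iff)
          then show "x j \<in> ?P n j" using n(2) j by simp
        qed (use x in \<open>auto simp: power_set_def PiE_iff extensional_def\<close>)
        then show "x \<in> (\<Union>n\<in>{1..}. PiE {1..m} (?P n)) \<inter> ?E" using n(1) x by blast
      next
        fix x assume "x \<in> (\<Union>n\<in>{1..}. PiE {1..m} (?P n)) \<inter> ?E"
        then obtain n where n: "1 \<le> n" "x \<in> PiE {1..m} (?P n)" "x \<in> ?E" by auto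
        have "(T ^^ a i n) (x j) \<in> W (i, j)" if "i \<in> {1..l}" "j \<in> {1..m}" for i j
          using PiE_mem[OF n(2) that(2)] that(1) by simp
        then show "x \<in> G W" using n(1,3) unfolding G_def by blast
      qed
      ultimately show ?thesis unfolding openin_subtopology by blast
    qed
    have denseG: "subtopology ?Y ?E closure_of G W = topspace (subtopology ?Y ?E)" if W: "W \<in> \<Omega>" for W
      unfolding dense_intersects_open
    proof (intro allI impI, elim conjE)
      fix Q assume Q: "openin (subtopology ?Y ?E) Q" "Q \<noteq> {}"
      then obtain Q' where Q': "openin ?Y Q'" "Q = Q' \<inter> ?E" unfolding openin_subtopology by blast
      obtain x where x: "x \<in> Q'" "x \<in> ?E" using Q(2) Q'(2) by blast
      obtain U where U: "\<forall>j\<in>{1..m}. openin X (U j)" "x \<in> PiE {1..m} U" "PiE {1..m} U \<subseteq> Q'"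
        using Q'(1) x(1) unfolding power_space_def openin_product_topology_alt by blast
      have UE: "U j \<inter> E \<noteq> {}" if "j \<in> {1..m}" for j
        using PiE_mem[OF U(2) that] x(2) that by (auto simp: power_set_def PiE_iff)
      have "\<exists>n\<ge>1. \<forall>j\<in>{1..m}. \<exists>z\<in>U j \<inter> E. \<forall>i\<in>{1..l}. (T ^^ a i n) z \<in> W (i, j)"
      proof (rule mix)
        show "openin X (U j) \<and> U j \<inter> E \<noteq> {}" if "j \<in> {1..m}" for j
          using U(1) UE[OF that] that by simp
        show "openin X (W (i, j)) \<and> W (i, j) \<inter> E \<noteq> {}" if "i \<in> {1..l}" "j \<in> {1..m}" for i j
          using WO[OF W that] .
      qed
      then obtain n where n: "1 \<le> n" "\<forall>j\<in>{1..m}. \<exists>z\<in>U j \<inter> E. \<forall>i\<in>{1..l}. (T ^^ a i n) z \<in> W (i, j)"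
        by (elim exE conjE)
      have "\<forall>j\<in>{1..m}. \<exists>z. z \<in> U j \<inter> E \<and> (\<forall>i\<in>{1..l}. (T ^^ a i n) z \<in> W (i, j))"
        using n(2) by blast
      then obtain z where z: "\<forall>j\<in>{1..m}. z j \<in> U j \<inter> E \<and> (\<forall>i\<in>{1..l}. (T ^^ a i n) (z j) \<in> W (i, j))"
        by (rule bchoice[THEN exE])
      have zE: "restrict z {1..m} \<in> ?E" using z by (auto simp: power_set_def)
      have "restrict z {1..m} \<in> PiE {1..m} U" using z by auto
      then have "restrict z {1..m} \<in> Q" using U(3) zE Q'(2) by blast
      moreover have "restrict z {1..m} \<in> G W"
        using n(1) z zE unfolding G_def by (intro CollectI conjI exI[of _ n]) auto
      ultimately show "G W \<inter> Q \<noteq> {}" by blast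
    qed
    have topE: "topspace (subtopology ?Y ?E) = ?E" using YE by (simp add: Int_absorb1)
    have res: "residual_in (subtopology ?Y ?E) (?E \<inter> \<Inter>(G ` \<Omega>))"
      unfolding residual_in_def topE using cO openG denseG topE
      by (intro conjI exI[of _ "G ` \<Omega>"]) auto
    have "power_set l ?E \<subseteq> power_space l ?Y closure_of {(\<lambda>i\<in>{1..l}. (power_map m T ^^ a i n) x) | n. n \<ge> 1}"
      if x: "x \<in> ?E \<inter> \<Inter>(G ` \<Omega>)" for x
    proof
      fix y assume y: "y \<in> power_set l ?E"
      have ytop: "y \<in> topspace (power_space l ?Y)"
        using y YE by (auto simp: power_set_def[of l] power_space_def[of l] PiE_iff)
      have yi: "y i \<in> ?E" if "i \<in> {1..l}" for i using y that by (auto simp: power_set_def[of l])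
      show "y \<in> power_space l ?Y closure_of {(\<lambda>i\<in>{1..l}. (power_map m T ^^ a i n) x) | n. n \<ge> 1}"
        unfolding in_closure_of
      proof (intro conjI ytop allI impI, elim conjE)
        fix Q assume Q: "y \<in> Q" "openin (power_space l ?Y) Q"
        obtain U where U: "\<forall>i\<in>{1..l}. openin ?Y (U i)" "y \<in> PiE {1..l} U" "PiE {1..l} U \<subseteq> Q"
          using Q unfolding power_space_def[of l] openin_product_topology_alt by blast
        have "\<forall>i\<in>{1..l}. \<exists>V. (\<forall>j\<in>{1..m}. openin X (V j)) \<and> y i \<in> PiE {1..m} V \<and> PiE {1..m} V \<subseteq> U i"
        proof
          fix i assume i: "i \<in> {1..l}"
          have "openin (product_topology (\<lambda>_. X) {1..m}) (U i)" "y i \<in> U i"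
            using U(1) i PiE_mem[OF U(2) i] by (auto simp: power_space_def)
          then show "\<exists>V. (\<forall>j\<in>{1..m}. openin X (V j)) \<and> y i \<in> PiE {1..m} V \<and> PiE {1..m} V \<subseteq> U i"
            unfolding openin_product_topology_alt by blast
        qed
        then obtain V where V: "\<forall>i\<in>{1..l}. (\<forall>j\<in>{1..m}. openin X (V i j)) \<and> y i \<in> PiE {1..m} (V i) \<and> PiE {1..m} (V i) \<subseteq> U i"
          by (rule bchoice[THEN exE])
        have "\<forall>p\<in>{1..l} \<times> {1..m}. \<exists>B. B \<in> \<B> \<and> y (fst p) (snd p) \<in> B \<and> B \<subseteq> V (fst p) (snd p)"
        proof
          fix p assume p: "p \<in> {1..l} \<times> {1..m}"
          then have p': "fst p \<in> {1..l}" "snd p \<in> {1..m}" by auto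
          then have "openin X (V (fst p) (snd p))" "y (fst p) (snd p) \<in> V (fst p) (snd p)"
            using V[rule_format, OF p'(1)] PiE_mem[OF _ p'(2)] by blast+
          then show "\<exists>B. B \<in> \<B> \<and> y (fst p) (snd p) \<in> B \<and> B \<subseteq> V (fst p) (snd p)" using \<B>(3) by blast
        qed
        then obtain W where W: "\<forall>p\<in>{1..l} \<times> {1..m}. W p \<in> \<B> \<and> y (fst p) (snd p) \<in> W p \<and> W p \<subseteq> V (fst p) (snd p)"
          by (rule bchoice[THEN exE])
        have yE: "y i j \<in> E" if "i \<in> {1..l}" "j \<in> {1..m}" for i j
          using yi[OF that(1)] that(2) by (auto simp: power_set_def)
        have "restrict W ({1..l} \<times> {1..m}) \<in> \<Omega>"
          unfolding \<Omega>_def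
        proof (intro CollectI conjI ballI)
          show "restrict W ({1..l} \<times> {1..m}) \<in> {1..l} \<times> {1..m} \<rightarrow>\<^sub>E \<B>"
            using W by (intro restrict_PiE_iff[THEN iffD2] ballI) blast
          fix p assume p: "p \<in> {1..l} \<times> {1..m}"
          then have "y (fst p) (snd p) \<in> E" by (intro yE) auto
          moreover have "y (fst p) (snd p) \<in> W p" using W p by blast
          ultimately show "restrict W ({1..l} \<times> {1..m}) p \<inter> E \<noteq> {}" using p by auto
        qed
        then have "x \<in> G (restrict W ({1..l} \<times> {1..m}))" using x by blast
        then obtain n where n: "1 \<le> n"
          "\<forall>i\<in>{1..l}. \<forall>j\<in>{1..m}. (T ^^ a i n) (x j) \<in> restrict W ({1..l} \<times> {1..m}) (i, j)"
          unfolding G_def by blast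
        have xE: "x \<in> ?E" using x by blast
        have "(power_map m T ^^ a i n) x \<in> U i" if i: "i \<in> {1..l}" for i
        proof -
          have "(T ^^ a i n) (x j) \<in> V i j" if j: "j \<in> {1..m}" for j
          proof -
            have "W (i, j) \<subseteq> V i j" using W i j by fastforce
            moreover have "(T ^^ a i n) (x j) \<in> W (i, j)" using n(2) i j by auto
            ultimately show ?thesis by blast
          qed
          then have "(\<lambda>j\<in>{1..m}. (T ^^ a i n) (x j)) \<in> PiE {1..m} (V i)" by simp
          then show ?thesis unfolding pw[OF xE] using V i by blast
        qed
        then have "(\<lambda>i\<in>{1..l}. (power_map m T ^^ a i n) x) \<in> PiE {1..l} U" by simp
        then show "\<exists>z. z \<in> {(\<lambda>i\<in>{1..l}. (power_map m T ^^ a i n) x) | n. n \<ge> 1} \<and> z \<in> Q"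
          using U(3) n(1) by blast
      qed
    qed
    then show ?thesis
      unfolding Delta_transitive_def using clE res by blast
  qed
  then show ?thesis using E by (simp add: Delta_weakly_mixing_def)
qed

section \<open>Construction of the mixing set\<close>

text \<open>
  The disjoint pair in a stage guarantees that it has at least two members, which
  shrinking needs, and in the end separates two points of the limit set.
\<close>

definition independent_stage :: "'a topology \<Rightarrow> ('a \<Rightarrow> 'a) \<Rightarrow> 'a set set \<Rightarrow> bool" where
  "independent_stage X T \<C> \<longleftrightarrow> finite \<C> \<and> (\<forall>C\<in>\<C>. closedin X C) \<and>
     densely_independent X T \<C> (\<lambda>C. C) \<and> (\<exists>C\<in>\<C>. \<exists>D\<in>\<C>. C \<inter> D = {})"

text \<open>
  Split the stage along the sequences, then cut every set of the split family into small
  closed pieces and keep one piece of each.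
\<close>

lemma (in Metric_space) next_stage:
  assumes pos: "positive_sequences l a" and cond: "condition_ss l a"
    and good: "good_for_liminf_recurrence l a"
    and comp: "compact_space mtopology" and T: "continuous_map mtopology mtopology T"
    and stage: "independent_stage mtopology T \<C>" and "0 < \<epsilon>"
  shows "\<exists>\<C>'. independent_stage mtopology T \<C>' \<and>
    (\<forall>C'\<in>\<C>'. (\<exists>C\<in>\<C>. C' \<subseteq> C) \<and> (\<forall>x\<in>C'. \<forall>y\<in>C'. d x y < \<epsilon>)) \<and>
    (\<exists>n\<ge>1. \<forall>C\<in>\<C>. \<forall>f\<in>{1..l} \<rightarrow>\<^sub>E \<C>. \<exists>C'\<in>\<C>'. C' \<subseteq> C \<and> (\<forall>i\<in>{1..l}. \<forall>x\<in>C'. (T ^^ a i n) x \<in> f i))"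
proof -
  have fin: "finite \<C>" and closed: "\<And>C. C \<in> \<C> \<Longrightarrow> closedin mtopology C"
    and dense: "densely_independent mtopology T \<C> (\<lambda>C. C)"
    using stage by (auto simp: independent_stage_def)
  obtain C0 D0 where CD: "C0 \<in> \<C>" "D0 \<in> \<C>" "C0 \<inter> D0 = {}"
    using stage by (auto simp: independent_stage_def)
  have CM: "C \<subseteq> M" if "C \<in> \<C>" for C using closedin_subset[OF closed[OF that]] by simp
  have C0ne: "C0 \<noteq> {}" using densely_independent_nonempty[OF dense CD(1)] .
  have Tf: "T \<in> topspace mtopology \<rightarrow> topspace mtopology"
    using T by (rule continuous_map_funspace)
  have Cne: "\<C> \<noteq> {}" using CD by blast
  define S where "S = \<C> \<times> ({1..l} \<rightarrow>\<^sub>E \<C>)"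
  obtain n where n: "1 \<le> n"
    "densely_independent mtopology T S (\<lambda>(C, f). {x\<in>C. \<forall>i\<in>{1..l}. (T ^^ a i n) x \<in> f i})"
    using densely_independent_extend[OF pos cond good Tf Cne dense] unfolding S_def by blast
  define A where "A = (\<lambda>(C, f). {x\<in>C. \<forall>i\<in>{1..l}. (T ^^ a i n) x \<in> f i})"
  have nA: "densely_independent mtopology T S A" using n(2) by (simp add: A_def)
  have finS: "finite S" using fin by (auto simp: S_def intro!: finite_PiE)
  have cardS: "2 \<le> card S"
  proof -
    let ?g = "\<lambda>i\<in>{1..l}. C0"
    have "{(C0, ?g), (D0, ?g)} \<subseteq> S" using CD by (auto simp: S_def)
    then have "card {(C0, ?g), (D0, ?g)} \<le> card S" using finS by (rule card_mono[rotated])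
    moreover have "C0 \<noteq> D0" using CD(3) C0ne by blast
    ultimately show ?thesis by simp
  qed
  have closedA: "closedin mtopology (A s)" if s: "s \<in> S" for s
  proof -
    obtain C f where Cf: "s = (C, f)" "C \<in> \<C>" "f \<in> {1..l} \<rightarrow>\<^sub>E \<C>" using s by (auto simp: S_def)
    have l: "1 \<le> l" using pos by (simp add: positive_sequences_def)
    have "closedin mtopology {x \<in> topspace mtopology. (T ^^ a i n) x \<in> f i}" if "i \<in> {1..l}" for i
      using PiE_mem[OF Cf(3) that]
      by (intro closedin_continuous_map_preimage[OF continuous_map_funpow[OF T]] closed)
    then have "closedin mtopology (C \<inter> (\<Inter>i\<in>{1..l}. {x \<in> topspace mtopology. (T ^^ a i n) x \<in> f i}))"
      using l by (intro closedin_Int[OF closed[OF Cf(2)]] closedin_Inter) auto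
    also have "C \<inter> (\<Inter>i\<in>{1..l}. {x \<in> topspace mtopology. (T ^^ a i n) x \<in> f i}) = A s"
      using CM[OF Cf(2)] l by (auto simp: A_def Cf(1))
    finally show ?thesis .
  qed
  obtain \<K> where K: "finite \<K>" "\<forall>K\<in>\<K>. closedin mtopology K \<and> (\<forall>x\<in>K. \<forall>y\<in>K. d x y < \<epsilon>)" "\<Union>\<K> = M"
    by (rule finite_small_closed_cover[OF comp \<open>0 < \<epsilon>\<close>])
  have "A s \<subseteq> (\<Union>K\<in>\<K>. A s \<inter> K)" if "s \<in> S" for s
    using closedin_subset[OF closedA[OF that]] K(3) by auto
  from densely_independent_refine[OF finS cardS K(1) this nA]
  obtain p where p: "\<forall>s\<in>S. p s \<in> \<K>" "densely_independent mtopology T S (\<lambda>s. A s \<inter> p s)" by blast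
  define \<C>' where "\<C>' = (\<lambda>s. A s \<inter> p s) ` S"
  have children: "\<exists>C'\<in>\<C>'. C' \<subseteq> C \<and> (\<forall>i\<in>{1..l}. \<forall>x\<in>C'. (T ^^ a i n) x \<in> f i)"
    if "C \<in> \<C>" "f \<in> {1..l} \<rightarrow>\<^sub>E \<C>" for C f
    using that by (intro bexI[of _ "A (C, f) \<inter> p (C, f)"]) (auto simp: \<C>'_def S_def A_def)
  have const: "(\<lambda>i\<in>{1..l}. C0) \<in> {1..l} \<rightarrow>\<^sub>E \<C>" using CD(1) by simp
  obtain C1 D1 where "C1 \<in> \<C>'" "C1 \<subseteq> C0" "D1 \<in> \<C>'" "D1 \<subseteq> D0"
    using children[OF CD(1) const] children[OF CD(2) const] by blast
  then have "\<exists>C\<in>\<C>'. \<exists>D\<in>\<C>'. C \<inter> D = {}"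
    using CD(3) by (intro bexI[of _ C1] bexI[of _ D1]) auto
  moreover have "\<forall>C\<in>\<C>'. closedin mtopology C"
    unfolding \<C>'_def using closedA p(1) K(2) by (auto intro!: closedin_Int)
  ultimately have "independent_stage mtopology T \<C>'"
    unfolding independent_stage_def
    using finS densely_independent_image[OF p(2)] by (simp add: \<C>'_def)
  moreover have "(\<exists>C\<in>\<C>. C' \<subseteq> C) \<and> (\<forall>x\<in>C'. \<forall>y\<in>C'. d x y < \<epsilon>)" if C': "C' \<in> \<C>'" for C'
  proof -
    obtain s where s: "s \<in> S" "C' = A s \<inter> p s" using C' by (auto simp: \<C>'_def)
    have "A s \<subseteq> fst s" "fst s \<in> \<C>" using s(1) by (auto simp: A_def S_def)
    then have "\<exists>C\<in>\<C>. C' \<subseteq> C" using s(2) by (intro bexI[of _ "fst s"]) auto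
    moreover have "\<forall>x\<in>p s. \<forall>y\<in>p s. d x y < \<epsilon>"
      using K(2)[THEN bspec, OF p(1)[THEN bspec, OF s(1)]] by (rule conjunct2)
    then have "\<forall>x\<in>C'. \<forall>y\<in>C'. d x y < \<epsilon>" using s(2) by simp
    ultimately show ?thesis by blast
  qed
  then have "\<forall>C'\<in>\<C>'. (\<exists>C\<in>\<C>. C' \<subseteq> C) \<and> (\<forall>x\<in>C'. \<forall>y\<in>C'. d x y < \<epsilon>)" by (rule ballI)
  moreover have "\<forall>C\<in>\<C>. \<forall>f\<in>{1..l} \<rightarrow>\<^sub>E \<C>. \<exists>C'\<in>\<C>'. C' \<subseteq> C \<and> (\<forall>i\<in>{1..l}. \<forall>x\<in>C'. (T ^^ a i n) x \<in> f i)"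
    using children by (intro ballI)
  ultimately show ?thesis using n(1) by (intro exI[of _ \<C>'] conjI exI[of _ n])
qed

theorem theorem1p2:
  fixes l :: nat and a :: "nat \<Rightarrow> nat \<Rightarrow> nat"
    and X :: "'a topology" and T :: "'a \<Rightarrow> 'a"
  assumes "positive_sequences l a"
    and "condition_ss l a"
    and "good_for_liminf_recurrence l a"
    and "topological_dynamical_system X T"
    and "topological_entropy X T > 0"
  shows "\<exists>E. (\<exists>x\<in>E. \<exists>y\<in>E. x \<noteq> y) \<and> Delta_weakly_mixing l a X T E"
proof -
  obtain M d where "Metric_space M d" and X: "X = Metric_space.mtopology M d"
    using assms(4) unfolding topological_dynamical_system_def metrizable_space_def by blast
  interpret Metric_space M d by fact
  have comp: "compact_space X" and T: "continuous_map X X T"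
    using assms(4) by (simp_all add: topological_dynamical_system_def homeomorphic_imp_continuous_map)
  obtain A B where AB: "closedin X A" "closedin X B" "A \<inter> B = {}" "densely_independent X T {A, B} (\<lambda>C. C)"
    using assms(4,5) by (rule positive_entropy_imp_independent_pair)
  have stage0: "independent_stage X T {A, B}"
    unfolding independent_stage_def using AB by auto
  let ?next = "\<lambda>k \<C> \<C>'.
    (\<forall>C'\<in>\<C>'. (\<exists>C\<in>\<C>. C' \<subseteq> C) \<and> (\<forall>x\<in>C'. \<forall>y\<in>C'. d x y < 1 / Suc k)) \<and>
    (\<exists>n\<ge>1. \<forall>C\<in>\<C>. \<forall>f\<in>{1..l} \<rightarrow>\<^sub>E \<C>. \<exists>C'\<in>\<C>'. C' \<subseteq> C \<and> (\<forall>i\<in>{1..l}. \<forall>x\<in>C'. (T ^^ a i n) x \<in> f i))"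
  have "\<exists>\<C>. \<forall>k. independent_stage X T (\<C> k) \<and> ?next k (\<C> k) (\<C> (Suc k))"
  proof (rule dependent_nat_choice[where P="\<lambda>_. independent_stage X T"])
    show "\<exists>\<C>. independent_stage X T \<C>" using stage0 by blast
    show "\<exists>\<C>'. independent_stage X T \<C>' \<and> ?next k \<C> \<C>'" if "independent_stage X T \<C>" for \<C> k
      using next_stage[OF assms(1-3) comp[unfolded X] T[unfolded X] that[unfolded X], of "1 / Suc k"]
      unfolding X by simp
  qed
  then obtain \<C> where seq: "\<forall>k. independent_stage X T (\<C> k) \<and> ?next k (\<C> k) (\<C> (Suc k))"
    by (rule exE)
  have stage: "independent_stage X T (\<C> k)" for k using seq[THEN spec, of k] by (rule conjunct1)
  have nxt: "?next k (\<C> k) (\<C> (Suc k))" for k using seq[THEN spec, of k] by (rule conjunct2)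
  have closed: "closedin X C" if "C \<in> \<C> k" for C k using stage[of k] that by (simp add: independent_stage_def)
  have ne: "C \<noteq> {}" if "C \<in> \<C> k" for C k
    using stage[of k] that densely_independent_nonempty[of X T "\<C> k" "\<lambda>C. C" C]
    by (simp add: independent_stage_def)
  have down: "\<exists>C\<in>\<C> k. C' \<subseteq> C" and small: "\<And>x y. x \<in> C' \<Longrightarrow> y \<in> C' \<Longrightarrow> d x y < 1 / Suc k"
    if "C' \<in> \<C> (Suc k)" for C' k
    using nxt[of k, THEN conjunct1, rule_format, OF that] by simp_all
  have split: "\<exists>n\<ge>1. \<forall>C\<in>\<C> k. \<forall>f\<in>{1..l} \<rightarrow>\<^sub>E \<C> k. \<exists>C'\<in>\<C> (Suc k). C' \<subseteq> C \<and> (\<forall>i\<in>{1..l}. \<forall>x\<in>C'. (T ^^ a i n) x \<in> f i)" for k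
    using nxt[of k] by (rule conjunct2)
  define E where "E = (\<Inter>k. \<Union>(\<C> k))"
  have E: "closedin X E"
    unfolding E_def
  proof (rule closedin_Inter)
    fix Q assume "Q \<in> range (\<lambda>k. \<Union>(\<C> k))"
    then obtain k where "Q = \<Union>(\<C> k)" by blast
    moreover have "finite (\<C> k)" using stage[of k] by (simp add: independent_stage_def)
    ultimately show "closedin X Q" using closed by (auto intro: closedin_Union)
  qed simp
  have dec: "\<Union>(\<C> (k + j)) \<subseteq> \<Union>(\<C> k)" for k j
  proof (induction j)
    case (Suc j)
    have "\<Union>(\<C> (Suc (k + j))) \<subseteq> \<Union>(\<C> (k + j))" using down by blast
    then show ?case using Suc by simp
  qed simp
  \<comment> \<open>descend through the children of \<open>C\<close> for constant targets and use compactness\<close>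
  have meets: "C \<inter> E \<noteq> {}" if C: "C \<in> \<C> k" for C k
  proof -
    have "\<exists>D. \<forall>j. (D j \<in> \<C> (k + j) \<and> (j = 0 \<longrightarrow> D j = C)) \<and> D (Suc j) \<subseteq> D j"
    proof (rule dependent_nat_choice)
      show "\<exists>D. D \<in> \<C> (k + 0) \<and> (0 = 0 \<longrightarrow> D = C)" using C by simp
      fix D j assume D: "D \<in> \<C> (k + j) \<and> (j = 0 \<longrightarrow> D = C)"
      then have const: "(\<lambda>i\<in>{1..l}. D) \<in> {1..l} \<rightarrow>\<^sub>E \<C> (k + j)" by simp
      obtain n where n: "\<forall>C\<in>\<C> (k + j). \<forall>f\<in>{1..l} \<rightarrow>\<^sub>E \<C> (k + j). \<exists>C'\<in>\<C> (Suc (k + j)).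
          C' \<subseteq> C \<and> (\<forall>i\<in>{1..l}. \<forall>x\<in>C'. (T ^^ a i n) x \<in> f i)"
        using split[of "k + j"] by (elim exE conjE)
      obtain C' where "C' \<in> \<C> (Suc (k + j))" "C' \<subseteq> D"
        using n[THEN bspec, THEN bspec, OF conjunct1[OF D] const] by (elim bexE conjE)
      then show "\<exists>D'. (D' \<in> \<C> (k + Suc j) \<and> (Suc j = 0 \<longrightarrow> D' = C)) \<and> D' \<subseteq> D" by auto
    qed
    then obtain D where D0: "\<forall>j. (D j \<in> \<C> (k + j) \<and> (j = 0 \<longrightarrow> D j = C)) \<and> D (Suc j) \<subseteq> D j"
      by (rule exE)
    have D: "D j \<in> \<C> (k + j)" "D 0 = C" "D (Suc j) \<subseteq> D j" for j
      using D0[THEN spec, of j] D0[THEN spec, of 0] by simp_all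
    have "(\<Inter>j. D j) \<noteq> {}"
    proof (rule compact_space_imp_nest[OF comp])
      show "decseq D" using D(3) by (rule decseq_SucI)
    qed (use D(1) closed ne in blast)+
    then obtain x where x: "\<And>j. x \<in> D j" by blast
    have "x \<in> \<Union>(\<C> j)" for j
    proof -
      have "x \<in> \<Union>(\<C> (k + j))" using x[of j] D(1) by blast
      then show ?thesis using dec[of j k] by (auto simp: add.commute)
    qed
    then have "x \<in> E" by (simp add: E_def)
    then show ?thesis using x[of 0] D(2) by blast
  qed
  \<comment> \<open>diameters tend to \<open>0\<close>, so late stages have a member around each point of \<open>E\<close> inside
    \<open>U\<close>\<close>
  have fits: "eventually (\<lambda>k. \<exists>C\<in>\<C> k. C \<subseteq> U) sequentially" if U: "openin X U" "U \<inter> E \<noteq> {}" for U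
  proof -
    obtain u where u: "u \<in> U" "u \<in> E" using U(2) by blast
    obtain r where r: "0 < r" "mball u r \<subseteq> U" using U(1) u(1) X openin_mtopology by blast
    obtain k0 where k0: "1 / Suc k0 < r" using r(1) nat_approx_posE by blast
    have "\<exists>C\<in>\<C> k. C \<subseteq> U" if k: "Suc k0 \<le> k" for k
    proof -
      obtain k' where k': "k = Suc k'" "k0 \<le> k'" using k by (cases k) auto
      obtain C where C: "C \<in> \<C> k" "u \<in> C" using u(2) unfolding E_def by blast
      have CM: "C \<subseteq> M" using closedin_subset[OF closed[OF C(1)]] X by simp
      have "1 / Suc k' \<le> 1 / Suc k0" using k'(2) by (simp add: frac_le)
      then have "d u y < r" if "y \<in> C" for y
        using small[of C k' u y] C that k0 k'(1) by simp
      then have "C \<subseteq> mball u r" using CM C(2) by auto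
      then show ?thesis using r(2) C(1) by blast
    qed
    then show ?thesis unfolding eventually_sequentially by blast
  qed
  have "Delta_weakly_mixing l a X T E"
  proof (rule Delta_weakly_mixing_criterion[OF assms(4) E])
    fix m :: nat and U V
    assume U: "\<And>j. j \<in> {1..m} \<Longrightarrow> openin X (U j) \<and> U j \<inter> E \<noteq> {}"
      and V: "\<And>i j. i \<in> {1..l} \<Longrightarrow> j \<in> {1..m} \<Longrightarrow> openin X (V i j) \<and> V i j \<inter> E \<noteq> {}"
    have ev: "eventually (\<lambda>k. (\<forall>j\<in>{1..m}. \<exists>C\<in>\<C> k. C \<subseteq> U j) \<and>
        (\<forall>j\<in>{1..m}. \<forall>i\<in>{1..l}. \<exists>C\<in>\<C> k. C \<subseteq> V i j)) sequentially"
      using fits U V by (intro eventually_conj eventually_ball_finite ballI) auto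
    obtain k where kU: "\<forall>j\<in>{1..m}. \<exists>C\<in>\<C> k. C \<subseteq> U j"
      and kV: "\<forall>j\<in>{1..m}. \<forall>i\<in>{1..l}. \<exists>C\<in>\<C> k. C \<subseteq> V i j"
      using eventually_happens'[OF sequentially_bot ev] by (elim exE conjE)
    obtain n where n: "1 \<le> n"
      "\<forall>C\<in>\<C> k. \<forall>f\<in>{1..l} \<rightarrow>\<^sub>E \<C> k. \<exists>C'\<in>\<C> (Suc k). C' \<subseteq> C \<and> (\<forall>i\<in>{1..l}. \<forall>x\<in>C'. (T ^^ a i n) x \<in> f i)"
      using split[of k] by blast
    have "\<exists>x\<in>U j \<inter> E. \<forall>i\<in>{1..l}. (T ^^ a i n) x \<in> V i j" if j: "j \<in> {1..m}" for j
    proof -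
      obtain C where C: "C \<in> \<C> k" "C \<subseteq> U j" using kU j by blast
      have "\<forall>i\<in>{1..l}. \<exists>D. D \<in> \<C> k \<and> D \<subseteq> V i j" using kV j by blast
      then obtain f where f: "\<forall>i\<in>{1..l}. f i \<in> \<C> k \<and> f i \<subseteq> V i j" by (rule bchoice[THEN exE])
      have rf: "restrict f {1..l} \<in> {1..l} \<rightarrow>\<^sub>E \<C> k" using f by auto
      obtain C' where C': "C' \<in> \<C> (Suc k)" "C' \<subseteq> C"
        "\<forall>i\<in>{1..l}. \<forall>x\<in>C'. (T ^^ a i n) x \<in> restrict f {1..l} i"
        using n(2)[THEN bspec, THEN bspec, OF C(1) rf] by (elim bexE conjE)
      obtain x where x: "x \<in> C'" "x \<in> E" using meets[OF C'(1)] by blast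
      have "(T ^^ a i n) x \<in> V i j" if "i \<in> {1..l}" for i
        using C'(3) x(1) f that by fastforce
      then show ?thesis using x C(2) C'(2) by blast
    qed
    then show "\<exists>n\<ge>1. \<forall>j\<in>{1..m}. \<exists>x\<in>U j \<inter> E. \<forall>i\<in>{1..l}. (T ^^ a i n) x \<in> V i j"
      using n(1) by blast
  qed
  moreover have "\<exists>x\<in>E. \<exists>y\<in>E. x \<noteq> y"
  proof -
    obtain C D where CD: "C \<in> \<C> 0" "D \<in> \<C> 0" "C \<inter> D = {}"
      using stage[of 0] by (auto simp: independent_stage_def)
    obtain x y where "x \<in> C" "x \<in> E" "y \<in> D" "y \<in> E"
      using meets[OF CD(1)] meets[OF CD(2)] by auto
    then show ?thesis using CD(3) by (intro bexI[of _ x] bexI[of _ y]) auto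
  qed
  ultimately show ?thesis by (intro exI[of _ E] conjI)
qed

end
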